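(* Let $F$ be a weakly $S(K_{1,3})$-free forest on $n$ vertices. Then $$\gamma_g(F)\leq\frac{3n}{5}\quad\text{and}\quad \gamma_g'(F)\leq\frac{3n+2}{5}.$$
   Context: Graphs are finite and simple. The domination game on a graph $G$ is played by two players, Dominator and Staller, who alternately choose a vertex of $G$ such that at least one previously undominated vertex becomes dominated (a chosen vertex dominates itself and its neighbors). The game ends when no such move is possible. Dominator wants the game to end as soon as possible, while Staller wants to prolong it. In the D-game Dominator moves first; in the S-game Staller moves first. When both players play optimally, the total number of vertices chosen is denoted $\gamma_g(G)$ for the D-game and $\gamma_g'(G)$ for the S-game. $S(K_{1,3})$ is the graph on 7 vertices obtained from the star $K_{1,3}$ by subdividing each edge exactly once. A leaf is a vertex of degree 1. A weakly $S(K_{1,3})$-free forest is a forest $F$ that has no isolated vertex and contains no induced subgraph isomorphic to $S(K_{1,3})$ whose three leaves are all leaves of $F$. *)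

theory Defs
  imports Complex_Main "Graph_Theory.Graph_Theory"
begin

text \<open>
  A finite simple graph is a symmetric digraph in the sense of the locale \<^locale>\<open>graph\<close>:
  an edge between u and v is the pair of arcs (u, v), (v, u), and the degree of a vertex is its
  \<^const>\<open>out_degree\<close>.
\<close>

section \<open>The domination game\<close>

definition closed_neighborhood :: "('a, 'b) pre_digraph \<Rightarrow> 'a \<Rightarrow> 'a set" where
  "closed_neighborhood G v = insert v {u. (v, u) \<in> arcs_ends G}"

definition legal_moves :: "('a, 'b) pre_digraph \<Rightarrow> 'a set \<Rightarrow> 'a set" where
  "legal_moves G D = {v \<in> verts G. \<not> closed_neighborhood G v \<subseteq> D}"

datatype player = Dominator | Staller

text \<open>
  The number of moves made under optimal play from the position in which D is the set of already
  dominated vertices and the given player is to move. The finiteness test only serves to make the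
  recursion terminate.
\<close>
function game_length :: "('a, 'b) pre_digraph \<Rightarrow> player \<Rightarrow> 'a set \<Rightarrow> nat" where
  "game_length G p D =
    (if \<not> fin_digraph G \<or> legal_moves G D = {} then 0
     else case p of
       Dominator \<Rightarrow>
         Suc (Min ((\<lambda>v. game_length G Staller (D \<union> closed_neighborhood G v)) ` legal_moves G D))
     | Staller \<Rightarrow>
         Suc (Max ((\<lambda>v. game_length G Dominator (D \<union> closed_neighborhood G v)) ` legal_moves G D)))"
  by pat_completeness auto

lemma card_undominated_less:
  assumes "fin_digraph G" and "v \<in> legal_moves G D"
  shows "card (verts G - (D \<union> closed_neighborhood G v)) < card (verts G - D)"
proof -
  interpret fin_digraph G by fact
  have v: "v \<in> verts G" and "\<not> closed_neighborhood G v \<subseteq> D"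
    using assms(2) by (auto simp: legal_moves_def)
  moreover have "closed_neighborhood G v \<subseteq> verts G"
    using v by (auto simp: closed_neighborhood_def arcs_ends_conv)
  ultimately show ?thesis
    by (intro psubset_card_mono) auto
qed

termination
  by (relation "measure (\<lambda>(G, p, D). card (verts G - D))") (auto intro: card_undominated_less)

declare game_length.simps [simp del]

definition game_domination_number :: "('a, 'b) pre_digraph \<Rightarrow> nat" (\<open>\<gamma>\<^sub>g\<close>) where
  "\<gamma>\<^sub>g G = game_length G Dominator {}"

definition staller_start_game_domination_number :: "('a, 'b) pre_digraph \<Rightarrow> nat" (\<open>\<gamma>\<^sub>g''\<close>) where
  "\<gamma>\<^sub>g' G = game_length G Staller {}"


section \<open>Weakly S(K13)-free forests\<close>

text \<open>
  The library predicate \<^const>\<open>forest\<close> cannot be used here: every edge of a symmetric digraph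
  yields a directed cycle u, v, u of length 2. The cycles of the undirected graph are the directed
  ones of length at least 3.
\<close>
definition undirected_forest :: "('a, 'b) pre_digraph \<Rightarrow> bool" where
  "undirected_forest G \<longleftrightarrow> graph G \<and> \<not> (\<exists>p. pre_digraph.cycle G p \<and> 3 \<le> length p)"

definition isolated :: "('a, 'b) pre_digraph \<Rightarrow> 'a \<Rightarrow> bool" where
  "isolated G v \<longleftrightarrow> v \<in> verts G \<and> out_degree G v = 0"

definition leaf :: "('a, 'b) pre_digraph \<Rightarrow> 'a \<Rightarrow> bool" where
  "leaf G v \<longleftrightarrow> v \<in> verts G \<and> out_degree G v = 1"

definition K13 :: "nat pair_pre_digraph" where
  "K13 = \<lparr> pverts = {0, 1, 2, 3}, parcs = {0} \<times> {1, 2, 3} \<union> {1, 2, 3} \<times> {0} \<rparr>"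

text \<open>
  Subdividing every edge exactly once: the new vertex on the edge between u and v is Inr {u, v}.
\<close>
definition subdivide_edges :: "('a, 'b) pre_digraph \<Rightarrow> ('a + 'a set) pair_pre_digraph" where
  "subdivide_edges G =
    \<lparr> pverts = Inl ` verts G \<union> (\<lambda>(u, v). Inr {u, v}) ` arcs_ends G,
      parcs = (\<Union>(u, v) \<in> arcs_ends G.
        {(Inl u, Inr {u, v}), (Inr {u, v}, Inl u), (Inl v, Inr {u, v}), (Inr {u, v}, Inl v)}) \<rparr>"

definition S_K13 :: "(nat + nat set) pair_pre_digraph" where
  "S_K13 = subdivide_edges (with_proj K13)"

definition weakly_S_K13_free_forest :: "('a, 'b) pre_digraph \<Rightarrow> bool" where
  "weakly_S_K13_free_forest F \<longleftrightarrow>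
    undirected_forest F \<and>
    (\<forall>v. \<not> isolated F v) \<and>
    \<not> (\<exists>H. induced_subgraph H F \<and> digraph_iso (with_proj S_K13) H \<and>
          (\<forall>v. leaf H v \<longrightarrow> leaf F v))"

lemma K13_complete_bipartite: "complete_bipartite_digraph 1 3 (with_proj K13)"
  unfolding complete_bipartite_digraph_pair_def
  by (intro conjI exI[of _ "{0}"] exI[of _ "{1, 2, 3}"]) (auto simp: K13_def)

lemma parcs_S_K13:
  "parcs S_K13 = (\<Union>i \<in> {1, 2, 3}.
    {(Inl 0, Inr {0, i}), (Inr {0, i}, Inl 0), (Inl i, Inr {0, i}), (Inr {0, i}, Inl i)})"
  unfolding S_K13_def subdivide_edges_def with_proj_simps K13_def
  by (simp add: Sigma_Un_distrib1 insert_commute Times_insert_left)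

lemma pverts_S_K13:
  "pverts S_K13 = {Inl 0, Inl 1, Inl 2, Inl 3, Inr {0, 1}, Inr {0, 2}, Inr {0, 3}}"
  by (auto simp: S_K13_def subdivide_edges_def K13_def insert_commute)

lemma card_S_K13: "card (pverts S_K13) = 7"
  by (auto simp: pverts_S_K13 card_insert_if doubleton_eq_iff)

end

theory Submission
  imports Defs
begin

text \<open>
  Call an undominated vertex white, a dominated vertex red if its whole closed neighbourhood is
  dominated, and any other dominated vertex blue. The proof is a weight argument. White vertices
  weigh 3, red vertices 0, and a blue vertex weighs 2 or 3; those of weight 2 are called light.
  At the start the total weight is 3n. If every move of Staller costs at least 3 and Dominator
  always has a move that costs at least 7, then five units of weight are available for each move,
  and the game lasts at most w/5 moves when Dominator starts and at most (w+2)/5 when Staller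
  starts, where w is the total weight.

  The difficulty is the choice of the light vertices. Call a white vertex a support if it has a
  white leaf neighbour, and a vertex a center if it has two supports as neighbours. The middle
  vertex of a path on five vertices is a center, and once it is dominated three more moves
  are made there under best play, so that the path must still weigh 15: a blue center cannot be
  light. But then Staller gets away with a cost of 2 when playing a light vertex all of whose
  white neighbours are centers. The predicate \<open>valid\<close> describes labellings for which this is impossible: a light
  vertex either has a private guard, a white neighbour that is cut off with its leaf from all other
  white vertices, or all its white neighbours lie in a region Z of white vertices that contains no
  center and no guard and is closed under white adjacency. Every move of Staller then costs at
  least 3 (\<open>staller_step\<close>).

  As long as a white center exists, an extremal one provides Dominator with a move of cost 7 that
  keeps the labelling valid (\<open>dominator_step_center\<close>). When no white center is left, all blue
  vertices other than centers may be declared light, and moves of cost 7 exist until no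
  white vertex has two white neighbours and no center is left at all (\<open>dominator_dichotomy\<close>); the
  exclusion of S(K13) enters in both phases through the fact that a center, having only two
  supports, stops being one when either of them is dominated (\<open>center_killed\<close>). In the remaining
  positions Dominator plays an end of a white edge, at a cost of 6; any reply of Staller that costs
  only 3 leaves Dominator a move of cost 8 (\<open>staller_reply\<close>). If there is no white edge either,
  each white vertex has a blue neighbour of its own, so that five units of weight are left for each
  white vertex, and every move dominates at least one of them
  (\<open>five_card_undominated_le\<close>).
\<close>

section \<open>Neighbourhoods, cycles and the excluded subgraph\<close>

definition nbs :: "('a, 'b) pre_digraph \<Rightarrow> 'a \<Rightarrow> 'a set" where
  "nbs G v = {u. v \<rightarrow>\<^bsub>G\<^esub> u}"

lemma closed_neighborhood_eq: "closed_neighborhood G v = insert v (nbs G v)"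
  by (simp add: closed_neighborhood_def nbs_def)

context graph
begin

lemma nbs_sym: "u \<in> nbs G v \<longleftrightarrow> v \<in> nbs G u"
  using sym_arcs by (auto simp: nbs_def dest: arcs_ends_symmetric)

lemma nbs_irrefl: "v \<notin> nbs G v"
  using adj_not_same by (auto simp: nbs_def)

lemma nbs_subset: "nbs G v \<subseteq> verts G"
  by (auto simp: nbs_def dest: adj_in_verts)

lemma out_degree_induce_subgraph:
  assumes "u \<in> X"
  shows "out_degree (G \<restriction> X) u = card (nbs G u \<inter> X)"
proof -
  have "nbs G u \<inter> X = head G ` out_arcs (G \<restriction> X) u"
    using assms by (auto simp: nbs_def arcs_ends_conv image_iff out_arcs_def)
  moreover have "inj_on (head G) (out_arcs (G \<restriction> X) u)"
    using no_multi_arcs by (intro inj_onI) (auto simp: arc_to_ends_def out_arcs_def)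
  ultimately show ?thesis
    by (simp add: out_degree_def card_image)
qed

lemma out_degree_eq_card_nbs: "out_degree G v = card (nbs G v)"
  using out_degree_induce_subgraph[of v UNIV] by (simp add: out_degree_def out_arcs_def)

lemma awalk_of_sequence:
  assumes "\<And>j. j < n \<Longrightarrow> w (Suc j) \<in> nbs G (w j)" and "w 0 \<in> verts G"
  shows "\<exists>p. awalk (w 0) p (w n) \<and> awalk_verts (w 0) p = map w [0..<Suc n]"
  using assms
proof (induction n arbitrary: w)
  case 0
  then show ?case
    by (intro exI[of _ "[]"]) (simp add: awalk_Nil_iff)
next
  case (Suc n)
  have "w (Suc 0) \<in> verts G"
    using Suc.prems(1)[of 0] nbs_subset by blast
  then obtain p where p: "awalk (w (Suc 0)) p (w (Suc n))"
      "awalk_verts (w (Suc 0)) p = map (\<lambda>i. w (Suc i)) [0..<Suc n]"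
    using Suc.IH[of "\<lambda>i. w (Suc i)"] Suc.prems by auto
  obtain e where e: "e \<in> arcs G" "tail G e = w 0" "head G e = w (Suc 0)"
    using Suc.prems(1)[of 0] by (auto simp: nbs_def)
  have "map w [0..<Suc (Suc n)] = w 0 # map (\<lambda>i. w (Suc i)) [0..<Suc n]"
    by (simp only: map_upt_Suc)
  then show ?case
    using p e by (intro exI[of _ "e # p"]) (simp add: awalk_Cons_iff)
qed

text \<open>
  By finiteness some vertex repeats. Between two equal vertices at minimal distance d along the
  walk all vertices are distinct, and d is at least 3, because 1 would be a loop and 2 a
  backtracking step; so the walk contains a cycle of length d.
\<close>
lemma no_nonbacktracking_walk:
  assumes acyc: "\<not> (\<exists>p. cycle p \<and> 3 \<le> length p)"
  shows "\<not> (\<forall>i::nat. w (Suc i) \<in> nbs G (w i) \<and> w (Suc (Suc i)) \<noteq> w i)"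
proof
  assume w: "\<forall>i::nat. w (Suc i) \<in> nbs G (w i) \<and> w (Suc (Suc i)) \<noteq> w i"
  have inV: "w i \<in> verts G" for i
    using w nbs_subset nbs_sym by blast
  have "\<not> inj w"
    using inV finite_verts finite_imageD[of w UNIV] finite_subset[of "range w" "verts G"] by auto
  then obtain i j where ij: "i < j" "w j = w i"
    unfolding inj_def by (metis linorder_neqE_nat)
  have "j - i > 0" "w i = w (i + (j - i))"
    using ij by simp_all
  then have "\<exists>d. d > 0 \<and> (\<exists>i. w i = w (i + d))"
    by blast
  define d where "d = (LEAST d. d > 0 \<and> (\<exists>i. w i = w (i + d)))"
  from \<open>\<exists>d. _\<close> have d: "d > 0 \<and> (\<exists>i. w i = w (i + d))"
    unfolding d_def by (rule LeastI_ex)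
  then obtain k where k: "w (k + d) = w k" by metis
  have min: "w a \<noteq> w (a + e)" if "0 < e" "e < d" for a e
    using that not_less_Least[of e "\<lambda>d. d > 0 \<and> (\<exists>i. w i = w (i + d))"] unfolding d_def[symmetric] by metis
  have "d \<noteq> 1"
  proof
    assume "d = 1"
    then have "w (Suc k) = w k" using k by simp
    then show False using w nbs_irrefl by metis
  qed
  moreover have "d \<noteq> 2"
  proof
    assume "d = 2"
    then have "w (Suc (Suc k)) = w k" using k by simp
    then show False using w by blast
  qed
  ultimately have "3 \<le> d" using d by linarith
  obtain p where p: "awalk (w k) p (w (k + d))" "awalk_verts (w k) p = map (\<lambda>i. w (k + i)) [0..<Suc d]"
    using awalk_of_sequence[of d "\<lambda>i. w (k + i)"] w inV by auto
  have "tl (awalk_verts (w k) p) = map (\<lambda>i. w (k + i)) [1..<Suc d]"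
    unfolding p(2) map_tl[symmetric] by (simp only: tl_upt One_nat_def)
  moreover have "inj_on (\<lambda>i. w (k + i)) {1..<Suc d}"
  proof (rule linorder_inj_onI)
    fix a b assume "a < b" "a \<in> {1..<Suc d}" "b \<in> {1..<Suc d}"
    then show "w (k + a) \<noteq> w (k + b)"
      using min[of "b - a" "k + a"] by simp
  qed auto
  ultimately have "distinct (tl (awalk_verts (w k) p))"
    by (simp add: distinct_map del: upt_Suc)
  moreover have "length p = d"
    using length_awalk_verts[of "w k" p] unfolding p(2) by (simp del: upt_Suc)
  ultimately have "cycle p"
    unfolding cycle_def using p(1) k \<open>3 \<le> d\<close> by (intro exI[of _ "w k"]) auto
  with acyc \<open>3 \<le> d\<close> \<open>length p = d\<close> show False by auto
qed


lemma no_triangle: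
  assumes acyc: "\<not> (\<exists>p. cycle p \<and> 3 \<le> length p)"
    and "b \<in> nbs G a" "c \<in> nbs G b" "a \<in> nbs G c"
  shows False
proof -
  define w where "w i = (if i mod 3 = 0 then a else if i mod 3 = 1 then b else c)" for i :: nat
  have ne: "a \<noteq> b" "b \<noteq> c" "c \<noteq> a"
    using assms nbs_irrefl by auto
  have "w (Suc i) \<in> nbs G (w i) \<and> w (Suc (Suc i)) \<noteq> w i" for i
  proof -
    have Suc_mod: "Suc j mod 3 = (if j mod 3 = 2 then 0 else Suc (j mod 3))" for j :: nat
      by (simp add: mod_Suc)
    consider "i mod 3 = 0" | "i mod 3 = 1" | "i mod 3 = 2" by linarith
    then show ?thesis
      by cases (use assms ne in \<open>simp_all only: w_def Suc_mod if_True if_False, simp_all\<close>)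
  qed
  then show False
    using no_nonbacktracking_walk[OF acyc, of w] by blast
qed

text \<open>
  In a forest three supports around a vertex, together with their leaves, always induce S(K13):
  an edge between two of the supports would close a triangle.
\<close>
lemma ex_S_K13_with_leaves:
  fixes x y :: "nat \<Rightarrow> 'a"
  assumes acyc: "\<not> (\<exists>p. cycle p \<and> 3 \<le> length p)"
    and x: "\<And>i. i \<in> {1,2,3} \<Longrightarrow> x i \<in> nbs G v"
    and y: "\<And>i. i \<in> {1,2,3} \<Longrightarrow> nbs G (y i) = {x i}"
    and dist: "x 1 \<noteq> x 2" "x 1 \<noteq> x 3" "x 2 \<noteq> x 3"
  shows "\<exists>H. induced_subgraph H G \<and> digraph_iso (with_proj S_K13) H \<and> (\<forall>u. leaf H u \<longrightarrow> leaf G u)"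
proof -
  define f where "f = case_sum (\<lambda>i. if i = 0 then v else y i) (\<lambda>s::nat set. x (Max s))"
  define X where "X = f ` pverts S_K13"
  define H where "H = G \<restriction> X"
  have x': "x 1 \<in> nbs G v" "x 2 \<in> nbs G v" "x 3 \<in> nbs G v"
    and x'': "v \<in> nbs G (x 1)" "v \<in> nbs G (x 2)" "v \<in> nbs G (x 3)"
    and y': "nbs G (y 1) = {x 1}" "nbs G (y 2) = {x 2}" "nbs G (y 3) = {x 3}"
    using x y nbs_sym by auto
  have y'': "y 1 \<in> nbs G (x 1)" "y 2 \<in> nbs G (x 2)" "y 3 \<in> nbs G (x 3)"
    using y' nbs_sym by auto
  have fv: "f (Inl 0) = v" "f (Inl 1) = y 1" "f (Inl 2) = y 2" "f (Inl 3) = y 3"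
    "f (Inr {0,1}) = x 1" "f (Inr {0,2}) = x 2" "f (Inr {0,3}) = x 3"
    by (simp_all add: f_def)
  have X: "X = {v, y 1, y 2, y 3, x 1, x 2, x 3}"
    unfolding X_def pverts_S_K13 image_insert image_empty fv by simp
  have XV: "X \<subseteq> verts G"
    unfolding X using x' x'' y'' nbs_subset by blast
  have xx: "x i \<notin> nbs G (x j)" if "i \<in> {1,2,3}" "j \<in> {1,2,3}" for i j
    using no_triangle[OF acyc, of "x j" v "x i"] x that nbs_sym by blast
  have vx: "v \<noteq> x i" if "i \<in> {1,2,3}" for i
    using x[OF that] nbs_irrefl by metis
  have yx: "y i \<noteq> x j" if "i \<in> {1,2,3}" "j \<in> {1,2,3}" for i j
    using y[OF that(1)] x[OF that(2)] vx[OF that(1)] nbs_sym by (metis singletonD)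
  have yv: "y i \<noteq> v" if "i \<in> {1,2,3}" for i
    using y[OF that] x' dist by (metis singletonD)
  have yy: "y 1 \<noteq> y 2" "y 1 \<noteq> y 3" "y 2 \<noteq> y 3"
    using y' dist by auto
  have yx': "y 1 \<noteq> x 1" "y 1 \<noteq> x 2" "y 1 \<noteq> x 3" "y 2 \<noteq> x 1" "y 2 \<noteq> x 2" "y 2 \<noteq> x 3"
    "y 3 \<noteq> x 1" "y 3 \<noteq> x 2" "y 3 \<noteq> x 3" and vx': "v \<noteq> x 1" "v \<noteq> x 2" "v \<noteq> x 3" and yv': "y 1 \<noteq> v" "y 2 \<noteq> v" "y 3 \<noteq> v"
    using yx vx yv by blast+
  note ne = dist yy yx' vx' yv'
  have nv: "nbs G v \<inter> X = {x 1, x 2, x 3}"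
  proof -
    have "y i \<notin> nbs G v" if "i \<in> {1,2,3}" for i
      using y[OF that] vx[OF that] nbs_sym by (metis singletonD)
    then show ?thesis
      unfolding X using x' nbs_irrefl by auto
  qed
  have nx: "nbs G (x i) \<inter> X = {v, y i}" if i: "i \<in> {1,2,3}" for i
  proof -
    have 1: "y j \<notin> nbs G (x i)" if "j \<in> {1,2,3}" "j \<noteq> i" for j
    proof
      assume "y j \<in> nbs G (x i)"
      then have "x i = x j"
        using y[OF that(1)] nbs_sym by (metis singletonD)
      then show False
        using i that dist by auto
    qed
    have 2: "y i \<in> nbs G (x i)" "v \<in> nbs G (x i)"
      using y[OF i] x[OF i] nbs_sym by auto
    have 3: "x 1 \<notin> nbs G (x i)" "x 2 \<notin> nbs G (x i)" "x 3 \<notin> nbs G (x i)"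
      using xx i by blast+
    have 4: "i \<noteq> j \<Longrightarrow> y j \<notin> nbs G (x i)" if "j \<in> {1,2,3}" for j
      using 1 that by blast
    consider "i = 1" | "i = 2" | "i = 3" using i by blast
    then show ?thesis
      unfolding X using 2 3 4[of 1] 4[of 2] 4[of 3] by cases simp_all
  qed
  have ny: "nbs G (y i) \<inter> X = {x i}" if "i \<in> {1,2,3}" for i
    using y[OF that] that unfolding X by auto
  have inj_f: "inj_on f (pverts S_K13)"
  proof (rule eq_card_imp_inj_on)
    show "finite (pverts S_K13)"
      by (simp add: pverts_S_K13)
    have "card X = 7"
      unfolding X using ne by (simp add: card_insert_if eq_commute)
    then show "card (f ` pverts S_K13) = card (pverts S_K13)"
      by (simp add: X_def card_S_K13)
  qed
  define E where "E = (\<lambda>(a, b). (f a, f b)) ` parcs S_K13"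
  have E: "E = (\<Union>i \<in> {1,2,3}. {(v, x i), (x i, v), (y i, x i), (x i, y i)})"
    unfolding E_def parcs_S_K13 by (simp add: f_def)
  have ends: "(a, b) \<in> E \<longleftrightarrow> a \<in> X \<and> b \<in> nbs G a \<inter> X" for a b
  proof
    assume "(a, b) \<in> E"
    then obtain i where i: "i \<in> {1,2,3}" and "(a, b) \<in> {(v, x i), (x i, v), (y i, x i), (x i, y i)}"
      unfolding E by blast
    moreover have "v \<in> X" "x i \<in> X" "y i \<in> X"
      using i unfolding X by auto
    moreover have "x i \<in> nbs G v \<inter> X"
      using i unfolding nv by blast
    ultimately show "a \<in> X \<and> b \<in> nbs G a \<inter> X"
      using nx[OF i] ny[OF i] by auto
  next
    assume ab: "a \<in> X \<and> b \<in> nbs G a \<inter> X"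
    then have "a = v \<or> (\<exists>i \<in> {1,2,3}. a = x i \<or> a = y i)"
      unfolding X by blast
    then show "(a, b) \<in> E"
    proof (elim disjE bexE)
      assume "a = v"
      then have "b \<in> {x 1, x 2, x 3}"
        using ab nv by simp
      then show ?thesis
        unfolding E \<open>a = v\<close> by blast
    next
      fix i :: nat assume i: "i \<in> {1,2,3}" and "a = x i"
      then have "b \<in> {v, y i}"
        using ab nx by simp
      then show ?thesis
        unfolding E \<open>a = x i\<close> using i by blast
    next
      fix i :: nat assume i: "i \<in> {1,2,3}" and "a = y i"
      then have "b \<in> {x i}"
        using ab ny by simp
      then show ?thesis
        unfolding E \<open>a = y i\<close> using i by blast
    qed
  qed
  define arcof where "arcof = the_inv_into (arcs G) (arc_to_ends G)"
  have arcof: "arcof (a, b) \<in> arcs G" "tail G (arcof (a, b)) = a" "head G (arcof (a, b)) = b"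
    if "(a, b) \<in> E" for a b
  proof -
    have "(a, b) \<in> arc_to_ends G ` arcs G"
      using that unfolding ends by (auto simp: nbs_def arcs_ends_def)
    then have "arc_to_ends G (arcof (a, b)) = (a, b)" "arcof (a, b) \<in> arcs G"
      unfolding arcof_def using inj_on_arc_to_ends by (auto intro: f_the_inv_into_f the_inv_into_into)
    then show "arcof (a, b) \<in> arcs G" "tail G (arcof (a, b)) = a" "head G (arcof (a, b)) = b"
      by (auto simp: arc_to_ends_def)
  qed
  have arcs_H: "arcs H = arcof ` E"
  proof (intro equalityI subsetI)
    fix e assume "e \<in> arcs H"
    then have e: "e \<in> arcs G" "tail G e \<in> X" "head G e \<in> X"
      by (auto simp: H_def)
    then have "(tail G e, head G e) \<in> E"
      unfolding ends by (auto simp: nbs_def arcs_ends_conv)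
    moreover have "arcof (tail G e, head G e) = e"
      unfolding arcof_def using e(1) inj_on_arc_to_ends
      by (metis arc_to_ends_def the_inv_into_f_f)
    ultimately show "e \<in> arcof ` E" by force
  next
    fix e assume "e \<in> arcof ` E"
    then obtain a b where "(a, b) \<in> E" "e = arcof (a, b)" by auto
    then show "e \<in> arcs H"
      using arcof[of a b] ends[of a b] by (auto simp: H_def)
  qed
  define h where "h = \<lparr>iso_verts = f, iso_arcs = (\<lambda>(a, b). arcof (f a, f b)), iso_head = head G, iso_tail = tail G\<rparr>"
  have inE: "(f a, f b) \<in> E" if "(a, b) \<in> parcs S_K13" for a b
    using that unfolding E_def by force
  have wf: "wf_digraph (with_proj S_K13)"
    by unfold_locales (auto simp: parcs_S_K13 pverts_S_K13)
  have "pre_digraph.digraph_isomorphism (with_proj S_K13) h"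
    unfolding pre_digraph.digraph_isomorphism_def
  proof (intro conjI)
    show "inj_on (iso_arcs h) (arcs (with_proj S_K13))"
    proof (rule inj_onI)
      fix p q assume pq: "p \<in> arcs (with_proj S_K13)" "q \<in> arcs (with_proj S_K13)" "iso_arcs h p = iso_arcs h q"
      obtain a b c d where [simp]: "p = (a, b)" "q = (c, d)" by fastforce
      have "f a = f c" "f b = f d"
        using pq arcof[OF inE[of a b]] arcof[OF inE[of c d]] by (auto simp: h_def)
      moreover have "a \<in> pverts S_K13" "b \<in> pverts S_K13" "c \<in> pverts S_K13" "d \<in> pverts S_K13"
        using wf pq unfolding wf_digraph_def by auto
      ultimately show "p = q"
        using inj_f by (auto dest: inj_onD)
    qed
  qed (use wf inj_f arcof inE in \<open>auto simp: h_def\<close>)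
  moreover have "H = app_iso h (with_proj S_K13)"
  proof -
    have "arcof ` E = (\<lambda>(a, b). arcof (f a, f b)) ` parcs S_K13"
      unfolding E_def image_image by (simp add: case_prod_beta)
    then show ?thesis
      using arcs_H by (intro pre_digraph.equality) (auto simp: H_def h_def X_def)
  qed
  ultimately have "digraph_iso (with_proj S_K13) H"
    unfolding digraph_iso_def by blast
  moreover have "leaf G u" if "leaf H u" for u
  proof -
    have u: "u \<in> X" "card (nbs G u \<inter> X) = 1"
      using that out_degree_induce_subgraph[of u X] by (auto simp: leaf_def H_def)
    have "card (nbs G v \<inter> X) \<noteq> 1" "card (nbs G (x i) \<inter> X) \<noteq> 1" if "i \<in> {1,2,3}" for i
      using nv nx[OF that] dist yv[OF that] by auto
    then have "u = y 1 \<or> u = y 2 \<or> u = y 3"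
      using u unfolding X by auto
    then have "\<exists>i \<in> {1,2,3}. u = y i" by blast
    then show "leaf G u"
      unfolding leaf_def out_degree_eq_card_nbs using u(1) XV y by auto
  qed
  moreover have "induced_subgraph H G"
    unfolding H_def using XV by (rule induced_induce)
  ultimately show ?thesis by blast
qed


section \<open>Game positions and the weight function\<close>

abbreviation N :: "'a \<Rightarrow> 'a set" where "N \<equiv> nbs G"

abbreviation V :: "'a set" where "V \<equiv> verts G"

abbreviation play :: "'a set \<Rightarrow> 'a \<Rightarrow> 'a set" where
  "play D z \<equiv> D \<union> insert z (N z)"

lemma legal_moves_iff: "z \<in> legal_moves G D \<longleftrightarrow> z \<in> V \<and> \<not> insert z (N z) \<subseteq> D"
  by (simp add: legal_moves_def closed_neighborhood_eq)

lemma nbs_in_verts: "u \<in> N v \<Longrightarrow> u \<in> V \<and> v \<in> V"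
  using nbs_subset nbs_sym by blast

lemma finite_legal_moves: "finite (legal_moves G D)"
  by (simp add: legal_moves_def)

lemma card_play_less:
  "z \<in> legal_moves G D \<Longrightarrow> card (V - play D z) < card (V - D)"
  using card_undominated_less[OF fin_digraph] by (simp add: closed_neighborhood_eq)

lemma game_length_Dominator_le:
  assumes "z \<in> legal_moves G D"
  shows "game_length G Dominator D \<le> Suc (game_length G Staller (play D z))"
  using assms finite_legal_moves
  by (subst game_length.simps) (auto simp: closed_neighborhood_eq intro!: Min_le)

lemma game_length_Staller_obtain:
  assumes "legal_moves G D \<noteq> {}"
  obtains z where "z \<in> legal_moves G D"
    and "game_length G Staller D = Suc (game_length G Dominator (play D z))"
proof -
  let ?f = "\<lambda>v. game_length G Dominator (play D v)"
  have "game_length G Staller D = Suc (Max (?f ` legal_moves G D))"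
    using assms fin_digraph by (subst game_length.simps) (simp add: closed_neighborhood_eq)
  moreover have "Max (?f ` legal_moves G D) \<in> ?f ` legal_moves G D"
    using assms finite_legal_moves by (intro Max_in) auto
  ultimately show thesis using that by auto
qed

lemma game_length_no_moves: "legal_moves G D = {} \<Longrightarrow> game_length G p D = 0"
  by (subst game_length.simps) simp

lemma game_length_le_card: "game_length G p D \<le> card (V - D)"
proof (induction "card (V - D)" arbitrary: p D rule: less_induct)
  case less
  show ?case
  proof (cases "legal_moves G D = {}")
    case True
    then show ?thesis by (simp add: game_length_no_moves)
  next
    case False
    show ?thesis
    proof (cases p)
      case Dominator
      obtain z where z: "z \<in> legal_moves G D" using False by auto
      show ?thesis
        using less[OF card_play_less[OF z], of Staller] game_length_Dominator_le[OF z] card_play_less[OF z]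
        unfolding Dominator by linarith
    next
      case Staller
      obtain z where z: "z \<in> legal_moves G D"
        "game_length G Staller D = Suc (game_length G Dominator (play D z))"
        using game_length_Staller_obtain[OF False] .
      show ?thesis
        using less[OF card_play_less[OF z(1)], of Dominator] z(2) card_play_less[OF z(1)]
        unfolding Staller by linarith
    qed
  qed
qed

definition support :: "'a set \<Rightarrow> 'a \<Rightarrow> bool" where
  "support D x \<longleftrightarrow> x \<notin> D \<and> (\<exists>y. y \<notin> D \<and> N y = {x})"

definition center :: "'a set \<Rightarrow> 'a \<Rightarrow> bool" where
  "center D v \<longleftrightarrow> (\<exists>x \<in> N v. \<exists>x' \<in> N v. x \<noteq> x' \<and> support D x \<and> support D x')"

lemma support_antimono: "support D' x \<Longrightarrow> D \<subseteq> D' \<Longrightarrow> support D x"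
  by (auto simp: support_def)

lemma center_antimono: "center D' v \<Longrightarrow> D \<subseteq> D' \<Longrightarrow> center D v"
  unfolding center_def using support_antimono by blast

text \<open>
  U is the set of light vertices. It is only used for sets U of dominated vertices; otherwise a
  white vertex could get weight 2.
\<close>
definition weight :: "'a set \<Rightarrow> 'a set \<Rightarrow> 'a \<Rightarrow> int" where
  "weight U D v = (if insert v (N v) \<subseteq> D then 0 else if v \<in> U then 2 else 3)"

definition potential :: "'a set \<Rightarrow> 'a set \<Rightarrow> int" where
  "potential U D = (\<Sum>v \<in> V. weight U D v)"

lemma weight_simps:
  "insert v (N v) \<subseteq> D \<Longrightarrow> weight U D v = 0"
  "v \<notin> D \<Longrightarrow> v \<notin> U \<Longrightarrow> weight U D v = 3"
  "v \<in> U \<Longrightarrow> weight U D v \<le> 2"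
  "v \<in> U \<Longrightarrow> u \<in> N v \<Longrightarrow> u \<notin> D \<Longrightarrow> weight U D v = 2"
  "weight U D v \<ge> 0"
  by (auto simp: weight_def)

lemma weight_mono: "D \<subseteq> D' \<Longrightarrow> U \<subseteq> U' \<Longrightarrow> weight U' D' v \<le> weight U D v"
  by (auto simp: weight_def)

lemma potential_drop:
  fixes k :: "'a \<Rightarrow> int"
  assumes "D \<subseteq> D'" "U \<subseteq> U'" "S \<subseteq> V"
    and "\<And>v. v \<in> S \<Longrightarrow> weight U' D' v + k v \<le> weight U D v"
  shows "potential U' D' + sum k S \<le> potential U D"
proof -
  have fin: "finite S" using finite_subset[OF assms(3) finite_verts] .
  have "potential U D - potential U' D' = (\<Sum>v \<in> V. weight U D v - weight U' D' v)"
    by (simp add: potential_def sum_subtractf)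
  moreover have "(\<Sum>v \<in> S. weight U D v - weight U' D' v) \<le> (\<Sum>v \<in> V. weight U D v - weight U' D' v)"
    using weight_mono[OF assms(1,2)] assms(3) by (intro sum_mono2) auto
  moreover have "sum k S \<le> (\<Sum>v \<in> S. weight U D v - weight U' D' v)"
    using assms(4) by (intro sum_mono) force
  ultimately show ?thesis by linarith
qed

text \<open>
  The light vertices are those of A, each of which has the guard g u, and those of B, whose white
  neighbours are confined to the region Z. A guard has exactly one white neighbour, and that is a
  leaf: so once the guard is dominated, it can be put into B and its leaf into Z, which compensates for the
  vertex that it guarded and that must then become heavy. Only the white part of Z matters.
\<close>
definition valid :: "'a set \<Rightarrow> 'a set \<Rightarrow> 'a set \<Rightarrow> ('a \<Rightarrow> 'a) \<Rightarrow> 'a set \<Rightarrow> bool" where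
  "valid D A B g Z \<longleftrightarrow>
    A \<subseteq> D \<and> B \<subseteq> D \<and> A \<inter> B = {} \<and> inj_on g A \<and>
    (\<forall>u \<in> A. g u \<in> N u \<and> g u \<notin> D \<and> g u \<notin> Z \<and>
       (\<exists>y. y \<notin> D \<and> N y = {g u} \<and> N (g u) - D = {y})) \<and>
    (\<forall>c \<in> B. N c - D \<subseteq> Z) \<and>
    (\<forall>a \<in> Z - D. \<not> center D a \<and> N a - D \<subseteq> Z) \<and>
    (\<forall>u \<in> A \<union> B. \<not> center D u)"

lemma not_center_leaf: "N y = {x} \<Longrightarrow> \<not> center D y"
  by (auto simp: center_def)

section \<open>Every move of Staller costs at least 3\<close>

text \<open>
  Let L be the vertices whose guards become dominated by the move. They leave the labelling at a
  loss of 1 each, but their guards become light, at a gain of 1 each, and distinct vertices have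
  distinct guards. So these effects cancel, and it remains to find 3 units elsewhere. A white or a
  heavy vertex pays them by being played; a guarded vertex pays 2 by being played, and since
  it becomes red, the unit gained at its guard is kept; a vertex of B pays 2 and dominates a white vertex of
  Z, which is no guard and can be made light.
\<close>
lemma staller_step:
  assumes val: "valid D A B g Z" and z: "z \<in> legal_moves G D"
  shows "\<exists>A' B' Z'. valid (play D z) A' B' g Z' \<and>
    potential (A' \<union> B') (play D z) + 3 \<le> potential (A \<union> B) D"
proof -
  define D' where "D' = play D z"
  have DD': "D \<subseteq> D'" by (auto simp: D'_def)
  have zV: "z \<in> V" and zleg: "\<not> insert z (N z) \<subseteq> D"
    using z by (auto simp: legal_moves_iff)
  have AD: "A \<subseteq> D" and BD: "B \<subseteq> D" and AB: "A \<inter> B = {}" and inj: "inj_on g A"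
    using val by (auto simp: valid_def)
  have guard: "g u \<in> N u" "g u \<notin> D" "g u \<notin> Z" if "u \<in> A" for u
    using val that by (auto simp: valid_def)
  have "\<forall>u \<in> A. \<exists>y. y \<notin> D \<and> N y = {g u} \<and> N (g u) - D = {y}"
    using val by (auto simp: valid_def)
  then obtain l where l: "l u \<notin> D" "N (l u) = {g u}" "N (g u) - D = {l u}" if "u \<in> A" for u
    by metis
  have B: "N c - D \<subseteq> Z" if "c \<in> B" for c
    using val that by (auto simp: valid_def)
  have Z: "\<not> center D a" "N a - D \<subseteq> Z" if "a \<in> Z" "a \<notin> D" for a
    using val that by (auto simp: valid_def)
  have nc: "\<not> center D u" if "u \<in> A \<union> B" for u
    using val that by (auto simp: valid_def)
  define L where "L = {u \<in> A. g u \<in> D'}"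
  define A' where "A' = A - L"
  define B' where "B' = B \<union> g ` L \<union> (if z \<in> B then N z - D else {})"
  define Z' where "Z' = Z \<union> l ` L"
  have LA: "L \<subseteq> A" by (auto simp: L_def)
  have gLD: "g ` L \<inter> D = {}" using guard LA by auto
  have leaf_not_guard: "l u \<noteq> g u'" if "u \<in> A" "u' \<in> A" for u u'
  proof
    assume "l u = g u'"
    then have "u' \<in> N (l u)"
      using guard[OF that(2)] nbs_sym by metis
    then have "u' = g u" using l[OF that(1)] by simp
    then show False using guard[OF that(1)] that AD by auto
  qed
  have new_in_B': "(if z \<in> B then N z - D else {}) \<subseteq> Z"
    using B by auto
  have val': "valid D' A' B' g Z'"
    unfolding valid_def
  proof (intro conjI ballI)
    show "A' \<subseteq> D'" "inj_on g A'"
      using AD DD' inj by (auto simp: A'_def inj_on_def)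
    show "B' \<subseteq> D'"
      using BD DD' by (auto simp: B'_def L_def D'_def split: if_splits)
    show "A' \<inter> B' = {}"
      using AB AD gLD by (auto simp: A'_def B'_def split: if_splits)
  next
    fix u assume "u \<in> A'"
    then have u: "u \<in> A" "g u \<notin> D'" by (auto simp: A'_def L_def)
    show "g u \<in> N u" "g u \<notin> D'" using guard u by auto
    have "g u \<notin> l ` L"
      using leaf_not_guard u LA by (metis imageE subsetD)
    then show "g u \<notin> Z'"
      using guard u by (auto simp: Z'_def)
    have "l u \<notin> D'"
    proof
      assume "l u \<in> D'"
      then have "l u = z \<or> l u \<in> N z"
        using l[OF u(1)] by (auto simp: D'_def)
      then have "g u = z \<or> g u \<in> N z"
        using l[OF u(1)] nbs_sym by (metis singleton_iff)
      then show False using u by (auto simp: D'_def)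
    qed
    moreover have "N (g u) - D' = {l u}"
      using l[OF u(1)] \<open>l u \<notin> D'\<close> DD' by blast
    ultimately show "\<exists>y. y \<notin> D' \<and> N y = {g u} \<and> N (g u) - D' = {y}"
      using l[OF u(1)] by blast
  next
    fix c assume c: "c \<in> B'"
    show "N c - D' \<subseteq> Z'"
    proof -
      consider "c \<in> B" | u where "u \<in> L" "c = g u" | "c \<in> Z" "c \<notin> D"
        using c new_in_B' by (auto simp: B'_def split: if_splits)
      then show ?thesis
      proof cases
        case 2
        then have "u \<in> A" using LA by auto
        then have "N c - D = {l u}" using l(3) 2 by simp
        then show ?thesis using 2 DD' by (auto simp: Z'_def)
      next
        case 1
        from B[OF this] show ?thesis using DD' by (auto simp: Z'_def)
      next
        case 3
        from Z(2)[OF this] show ?thesis using DD' by (auto simp: Z'_def)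
      qed
    qed
  next
    fix a assume a: "a \<in> Z' - D'"
    then consider "a \<in> Z" "a \<notin> D" | u where "u \<in> L" "a = l u"
      using DD' by (auto simp: Z'_def)
    then show "\<not> center D' a"
    proof cases
      case 1
      then show ?thesis using Z(1) center_antimono[OF _ DD'] by blast
    next
      case 2
      then have "N a = {g u}" using l(2) LA by auto
      then show ?thesis by (rule not_center_leaf)
    qed
    from a consider "a \<in> Z" "a \<notin> D" | u where "u \<in> L" "a = l u"
      using DD' by (auto simp: Z'_def)
    then show "N a - D' \<subseteq> Z'"
    proof cases
      case 2
      then have "N a = {g u}" "g u \<in> D'" using l(2) LA by (auto simp: L_def)
      then have "N a \<subseteq> D'" by simp
      then show ?thesis by blast
    next
      case 1
      from Z(2)[OF this] show ?thesis using DD' by (auto simp: Z'_def)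
    qed
  next
    fix u assume u: "u \<in> A' \<union> B'"
    then consider "u \<in> A \<union> B" | w where "w \<in> L" "u = g w" | "u \<in> Z" "u \<notin> D"
      using new_in_B' by (auto simp: A'_def B'_def split: if_splits)
    then show "\<not> center D' u"
    proof cases
      case 2
      show ?thesis
      proof
        assume "center D' u"
        then obtain x x' where "x \<in> N u - D'" "x' \<in> N u - D'" "x \<noteq> x'"
          by (auto simp: center_def support_def)
        then have "x \<in> N u - D" "x' \<in> N u - D" "x \<noteq> x'" using DD' by auto
        moreover have "w \<in> A" "u = g w" using 2 LA by auto
        with l(3) have "N u - D = {l w}" by simp
        ultimately show False by simp
      qed
    next
      case 1
      then show ?thesis using nc center_antimono[OF _ DD'] by blast
    next
      case 3
      then show ?thesis using Z(1) center_antimono[OF _ DD'] by blast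
    qed
  qed
  \<comment> \<open>h is the loss of weight at v, corrected by the exchange between L and its guards; the
    corrections add up to 0.\<close>
  define h where "h v = weight (A \<union> B) D v - weight (A' \<union> B') D' v
      - (if v \<in> g ` L then 1 else 0) + (if v \<in> L then 1 else 0)" for v
  have LV: "L \<subseteq> V" "g ` L \<subseteq> V" using guard LA nbs_in_verts by blast+
  have "(\<Sum>v \<in> V. if v \<in> g ` L then 1 else 0 :: int) = card (g ` L)"
    using LV by (simp add: sum.If_cases Int_absorb1)
  moreover have "(\<Sum>v \<in> V. if v \<in> L then 1 else 0 :: int) = card L"
    using LV by (simp add: sum.If_cases Int_absorb1)
  moreover have "card (g ` L) = card L"
    using inj LA by (meson card_image inj_on_subset)
  ultimately have sum_h: "sum h V = potential (A \<union> B) D - potential (A' \<union> B') D'"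
    unfolding h_def potential_def by (simp add: sum.distrib sum_subtractf)
  have h_nonneg: "h v \<ge> 0" for v
  proof (cases "v \<in> g ` L")
    case True
    then have "v \<notin> A \<union> B" "v \<notin> D" "v \<in> B'" using gLD AD BD by (auto simp: B'_def)
    then show ?thesis
      using weight_simps(3)[of v "A' \<union> B'" D'] weight_simps(2)[of v D "A \<union> B"] True by (auto simp: h_def)
  next
    case F: False
    show ?thesis
    proof (cases "v \<in> L")
      case True
      then show ?thesis using F DD' by (auto simp: h_def weight_def)
    next
      case False
      then show ?thesis using F DD' by (auto simp: h_def weight_def A'_def B'_def)
    qed
  qed
  have h_lower: "sum h S \<le> sum h V" if "S \<subseteq> V" for S
    using that h_nonneg by (intro sum_mono2) auto
  have z_red: "weight (A' \<union> B') D' z = 0"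
    by (rule weight_simps) (auto simp: D'_def)
  have "sum h V \<ge> 3"
  proof -
    consider (white_guard) u where "u \<in> L" "z = g u" | (white) "z \<notin> D" "z \<notin> g ` L"
      | (heavy) "z \<in> D" "z \<notin> A \<union> B" | (A) "z \<in> A" | (B) "z \<in> B"
      by blast
    then show ?thesis
    proof cases
      case white_guard
      then have u: "u \<in> A" using LA by auto
      have zD: "z \<notin> D" and "z \<notin> A \<union> B" using guard u AD BD white_guard by auto
      then have "h z \<ge> 2"
        using z_red weight_simps(2)[of z D "A \<union> B"] by (auto simp: h_def)
      \<comment> \<open>Playing a guard also turns its leaf red, which makes up for the vertex that loses it.\<close>
      have y: "N (l u) = {z}" "l u \<notin> D" using l u white_guard by auto
      have yV: "l u \<in> V" "l u \<noteq> z" using y nbs_in_verts nbs_irrefl by blast+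
      have "insert (l u) (N (l u)) \<subseteq> D'"
        using y(1) nbs_sym by (auto simp: D'_def)
      moreover have "l u \<notin> g ` L" using leaf_not_guard u LA by auto
      moreover have "l u \<notin> A \<union> B" using y AD BD by auto
      ultimately have "h (l u) \<ge> 3"
        using weight_simps(1)[of "l u" D' "A' \<union> B'"] weight_simps(2)[of "l u" D "A \<union> B"] y
        by (auto simp: h_def)
      then show ?thesis
        using h_lower[of "{z, l u}"] yV zV \<open>h z \<ge> 2\<close> by auto
    next
      case white
      then have "z \<notin> A \<union> B" using AD BD by auto
      then have "h z \<ge> 3"
        using white z_red weight_simps(2)[of z D "A \<union> B"] by (auto simp: h_def)
      then show ?thesis using h_lower[of "{z}"] zV by auto
    next
      case heavy
      then have "h z \<ge> 3"
        using z_red zleg gLD by (auto simp: h_def weight_def)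
      then show ?thesis using h_lower[of "{z}"] zV by auto
    next
      case A
      then have "z \<in> L" using guard by (auto simp: L_def D'_def)
      moreover have "z \<notin> g ` L" using A AD gLD by auto
      moreover have "weight (A \<union> B) D z = 2"
        using A guard by (intro weight_simps(4)[of _ _ "g z"]) auto
      ultimately have "h z \<ge> 3" using z_red by (auto simp: h_def)
      then show ?thesis using h_lower[of "{z}"] zV by auto
    next
      case B
      then have "z \<in> D" "z \<notin> A" using BD AB by auto
      then obtain v where v: "v \<in> N z" "v \<notin> D" using zleg by auto
      have "weight (A \<union> B) D z = 2"
        using B v by (intro weight_simps(4)[of _ _ v]) auto
      then have "h z \<ge> 2" using z_red \<open>z \<in> D\<close> gLD by (auto simp: h_def)
      have "v \<in> Z" using val B v by (auto simp: valid_def)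
      then have "v \<notin> g ` L" using guard LA by auto
      moreover have "v \<in> B'" using B v by (auto simp: B'_def)
      moreover have "v \<notin> A \<union> B" using v AD BD by auto
      ultimately have "h v \<ge> 1"
        using weight_simps(3)[of v "A' \<union> B'" D'] weight_simps(2)[of v D "A \<union> B"] v AD BD
        by (auto simp: h_def)
      moreover have "z \<noteq> v" "v \<in> V" using v \<open>z \<in> D\<close> nbs_in_verts by auto
      ultimately show ?thesis
        using h_lower[of "{z, v}"] zV \<open>h z \<ge> 2\<close> by simp
    qed
  qed
  then show ?thesis
    using val' sum_h unfolding D'_def[symmetric] by (intro exI[of _ A'] exI[of _ B'] exI[of _ Z']) auto
qed

end

section \<open>Dominator's moves while a white center exists\<close>

locale forest_game = graph G for G (structure) +
  assumes weakly_free: "weakly_S_K13_free_forest G"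
begin

lemma acyclic_graph: "\<not> (\<exists>p. cycle p \<and> 3 \<le> length p)"
  using weakly_free by (simp add: weakly_S_K13_free_forest_def undirected_forest_def)

lemma nbs_nonempty: "v \<in> V \<Longrightarrow> N v \<noteq> {}"
  using weakly_free by (auto simp: weakly_S_K13_free_forest_def isolated_def out_degree_eq_card_nbs)

lemma at_most_two_supports:
  assumes "x\<^sub>1 \<in> N v" "x\<^sub>2 \<in> N v" "x\<^sub>3 \<in> N v" "support D x\<^sub>1" "support D x\<^sub>2" "support D x\<^sub>3"
  shows "x\<^sub>1 = x\<^sub>2 \<or> x\<^sub>1 = x\<^sub>3 \<or> x\<^sub>2 = x\<^sub>3"
proof (rule ccontr)
  assume ne: "\<not> ?thesis"
  obtain y\<^sub>1 y\<^sub>2 y\<^sub>3 where y: "N y\<^sub>1 = {x\<^sub>1}" "N y\<^sub>2 = {x\<^sub>2}" "N y\<^sub>3 = {x\<^sub>3}"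
    using assms(4-6) by (auto simp: support_def)
  define x where "x i = (if i = 1 then x\<^sub>1 else if i = 2 then x\<^sub>2 else x\<^sub>3)" for i :: nat
  define y where "y i = (if i = 1 then y\<^sub>1 else if i = 2 then y\<^sub>2 else y\<^sub>3)" for i :: nat
  have "\<exists>H. induced_subgraph H G \<and> digraph_iso (with_proj S_K13) H \<and> (\<forall>u. leaf H u \<longrightarrow> leaf G u)"
    by (rule ex_S_K13_with_leaves[OF acyclic_graph, of x v y])
      (use assms(1-3) y ne in \<open>auto simp: x_def y_def\<close>)
  then show False
    using weakly_free by (simp add: weakly_S_K13_free_forest_def)
qed

text \<open>
  The pairs are arcs between white vertices, and smaller than an arc are those that continue it
  without turning back. In a forest this relation is well-founded, which replaces
  arguments with longest paths and with the components left after deleting a vertex.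
\<close>
definition white_step :: "'a set \<Rightarrow> (('a \<times> 'a) \<times> ('a \<times> 'a)) set" where
  "white_step D = {((b, c), (a, b)) | a b c. a \<notin> D \<and> b \<in> N a - D \<and> c \<in> N b - D \<and> c \<noteq> a}"

lemma wf_white_step: "wf (white_step D)"
  unfolding wf_iff_no_infinite_down_chain
proof
  assume "\<exists>f. \<forall>i. (f (Suc i), f i) \<in> white_step D"
  then obtain f where f: "(f (Suc i), f i) \<in> white_step D" for i by blast
  define w where "w i = fst (f i)" for i
  have w: "w (Suc i) = snd (f i) \<and> w (Suc i) \<in> N (w i) \<and> snd (f (Suc i)) \<noteq> w i" for i
    using f[of i] by (auto simp: white_step_def w_def)
  then have "w (Suc i) \<in> N (w i) \<and> w (Suc (Suc i)) \<noteq> w i" for i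
    by metis
  then show False
    using no_nonbacktracking_walk[OF acyclic_graph, of w] by blast
qed

text \<open>
  Choose an arc (u, x) from a white center to one of its supports that is minimal. If there were
  a center q beyond it, reached by an arc from p, then one of the two supports of q would differ
  from p and lead to a smaller arc of the same kind.
\<close>
lemma ex_extremal_center:
  assumes "u\<^sub>0 \<notin> D" "center D u\<^sub>0"
  obtains u x where "u \<notin> D" "center D u" "x \<in> N u" "support D x"
    and "\<And>p q. ((p, q), (u, x)) \<in> (white_step D)\<^sup>* \<Longrightarrow> \<not> center D q"
proof -
  define Q where "Q = {(u, x). u \<notin> D \<and> center D u \<and> x \<in> N u \<and> support D x}"
  obtain x\<^sub>0 where "(u\<^sub>0, x\<^sub>0) \<in> Q"
    using assms by (auto simp: Q_def center_def)
  moreover have "wf ((white_step D)\<^sup>+)"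
    using wf_white_step by (rule wf_trancl)
  ultimately obtain u x where ux: "(u, x) \<in> Q" and min: "\<And>z. (z, (u, x)) \<in> (white_step D)\<^sup>+ \<Longrightarrow> z \<notin> Q"
    unfolding wf_eq_minimal by (metis surj_pair)
  have "\<not> center D q" if pq: "((p, q), (u, x)) \<in> (white_step D)\<^sup>*" for p q
  proof
    assume "center D q"
    then obtain x' where x': "x' \<in> N q" "x' \<noteq> p" "support D x'"
      by (auto simp: center_def)
    have "p \<notin> D \<and> q \<in> N p - D"
      using pq ux by (cases rule: converse_rtranclE) (auto simp: Q_def white_step_def support_def)
    then have "((q, x'), (p, q)) \<in> white_step D"
      using x' by (auto simp: white_step_def support_def)
    then have "((q, x'), (u, x)) \<in> (white_step D)\<^sup>+"
      using pq by (rule rtrancl_into_trancl2)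
    moreover have "(q, x') \<in> Q"
      using \<open>center D q\<close> x' \<open>p \<notin> D \<and> q \<in> N p - D\<close> by (auto simp: Q_def)
    ultimately show False using min by blast
  qed
  then show thesis
    using ux that by (auto simp: Q_def)
qed

lemma center_killed:
  assumes "center D c" "x \<in> N c" "support D x" "D \<subseteq> D'" "x \<in> D'"
  shows "\<not> center D' c"
proof
  assume "center D' c"
  then obtain a b where ab: "a \<in> N c" "b \<in> N c" "a \<noteq> b" "support D' a" "support D' b"
    by (auto simp: center_def)
  then have "support D a" "support D b"
    using support_antimono assms(4) by blast+
  moreover have "a \<noteq> x" "b \<noteq> x"
    using ab assms(5) by (auto simp: support_def)
  ultimately show False
    using at_most_two_supports[of a c b x D] ab assms by blast
qed

text \<open>
  A guard and its leaf form a component of the white vertices. So a move at a white vertex with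
  two white neighbours dominates no guard.
\<close>
lemma guard_not_adjacent:
  assumes "valid D A B g Z" "u' \<in> A" "a \<in> N x - D" "b \<in> N x - D" "a \<noteq> b" "x \<notin> D"
  shows "g u' \<notin> insert x (N x)"
proof
  obtain y where y: "N y = {g u'}" "N (g u') - D = {y}"
    using assms(1,2) by (auto simp: valid_def)
  assume "g u' \<in> insert x (N x)"
  then consider "g u' = x" | "x \<in> N (g u') - D" using nbs_sym assms(6) by auto
  then show False
  proof cases
    case 1
    then show False using y(2) assms(3-5) by auto
  next
    case 2
    then have "x = y" using y(2) by auto
    then show False using y(1) assms(3-5) by auto
  qed
qed

text \<open>
  Let u be an extremal center and x its support without centers beyond, with leaf y. If x has
  another white neighbour v, Dominator plays x: this costs 3 at x, 3 at y, and 1 at v, which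
  becomes light because the white vertices beyond v contain no center and can be added to Z.
  Otherwise u and y are the only white neighbours of x. Then Dominator plays the other support of
  u, which costs 6 at that support and its leaf, and u becomes light with guard x. It is no longer
  a center, for it has no third support.
\<close>
lemma dominator_step_center:
  assumes val: "valid D A B g Z" and "u\<^sub>0 \<notin> D" "center D u\<^sub>0"
  shows "\<exists>x \<in> legal_moves G D. \<exists>A' B' g' Z'. valid (play D x) A' B' g' Z' \<and>
    potential (A' \<union> B') (play D x) + 7 \<le> potential (A \<union> B) D"
proof -
  let ?S = "white_step D"
  obtain u x where u: "u \<notin> D" "center D u" and x: "x \<in> N u" "support D x"
    and ext: "\<And>p q. ((p, q), (u, x)) \<in> ?S\<^sup>* \<Longrightarrow> \<not> center D q"
    using ex_extremal_center assms(2,3) by blast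
  obtain y where y: "y \<notin> D" "N y = {x}" and xD: "x \<notin> D"
    using x by (auto simp: support_def)
  obtain x\<^sub>1 where x\<^sub>1: "x\<^sub>1 \<in> N u" "x\<^sub>1 \<noteq> x" "support D x\<^sub>1"
    using u by (auto simp: center_def)
  obtain y\<^sub>1 where y\<^sub>1: "y\<^sub>1 \<notin> D" "N y\<^sub>1 = {x\<^sub>1}" and x\<^sub>1D: "x\<^sub>1 \<notin> D"
    using x\<^sub>1 by (auto simp: support_def)
  have AD: "A \<subseteq> D" and BD: "B \<subseteq> D" and AB: "A \<inter> B = {}" and inj: "inj_on g A"
    using val by (auto simp: valid_def)
  have B: "N c - D \<subseteq> Z" if "c \<in> B" for c
    using val that by (auto simp: valid_def)
  have Z: "\<not> center D a" "N a - D \<subseteq> Z" if "a \<in> Z" "a \<notin> D" for a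
    using val that by (auto simp: valid_def)
  have nc: "\<not> center D w" if "w \<in> A \<union> B" for w
    using val that by (auto simp: valid_def)
  have guard: "g w \<in> N w" "g w \<notin> D" "g w \<notin> Z" "\<exists>y. y \<notin> D \<and> N y = {g w} \<and> N (g w) - D = {y}" if "w \<in> A" for w
    using val that by (auto simp: valid_def)
  have uy: "u \<noteq> y" "u \<noteq> y\<^sub>1" using x x\<^sub>1 y y\<^sub>1 by auto
  have xN: "u \<in> N x - D" "y \<in> N x - D" "u \<in> N x\<^sub>1 - D" "y\<^sub>1 \<in> N x\<^sub>1 - D"
    using x x\<^sub>1 y y\<^sub>1 u nbs_sym by auto
  have inV: "x \<in> V" "y \<in> V" "u \<in> V" "x\<^sub>1 \<in> V" "y\<^sub>1 \<in> V"
    using xN x\<^sub>1 nbs_in_verts by blast+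
  have guards_kept: "\<exists>y. y \<notin> play D t \<and> N y = {g w} \<and> N (g w) - play D t = {y}" "g w \<notin> play D t"
    if w: "w \<in> A" and t: "t \<notin> D" "a \<in> N t - D" "b \<in> N t - D" "a \<noteq> b" for w t a b
  proof -
    show gw: "g w \<notin> play D t"
      using guard_not_adjacent[OF val w t(2,3,4,1)] guard[OF w] by auto
    obtain l where l: "l \<notin> D" "N l = {g w}" "N (g w) - D = {l}"
      using guard[OF w] by blast
    have "l \<noteq> t" using l(2) t(2-4) by auto
    moreover have "l \<notin> N t" using l(2) gw nbs_sym by (metis UnI2 insertI1 singletonD)
    ultimately have "l \<notin> play D t" using l by auto
    then show "\<exists>y. y \<notin> play D t \<and> N y = {g w} \<and> N (g w) - play D t = {y}"
      using l by (intro exI[of _ l]) auto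
  qed
  show ?thesis
  proof (cases "N x - D = {u, y}")
    case False
    then obtain v where v: "v \<in> N x" "v \<notin> D" "v \<noteq> u" "v \<noteq> y"
      using xN by blast
    define D' where "D' = play D x"
    have DD': "D \<subseteq> D'" by (auto simp: D'_def)
    \<comment> \<open>The white vertices on the far side of v as seen from x.\<close>
    define X where "X = {q. \<exists>p. ((p, q), (x, v)) \<in> ?S\<^sup>*}"
    have xv: "((x, v), (u, x)) \<in> ?S"
      using v u x xD by (auto simp: white_step_def)
    have X_center: "\<not> center D q" if "q \<in> X" for q
      using that ext xv unfolding X_def by (blast intro: rtrancl_into_rtrancl)
    have chain: "p \<notin> D \<and> q \<in> N p \<and> q \<notin> D \<and> (q \<in> N x \<or> (\<exists>p'. ((p, q), (p', p)) \<in> ?S \<and> ((p', p), (x, v)) \<in> ?S\<^sup>*))"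
      if "((p, q), (x, v)) \<in> ?S\<^sup>*" for p q
      using that v xD by (cases rule: converse_rtranclE) (auto simp: white_step_def)
    have X_closed: "r \<in> X" if q: "q \<in> X" "q \<notin> D'" and r: "r \<in> N q" "r \<notin> D'" for q r
    proof -
      obtain p where pq: "((p, q), (x, v)) \<in> ?S\<^sup>*"
        using q by (auto simp: X_def)
      have "q \<notin> N x" using q by (auto simp: D'_def)
      then obtain p' where p': "((p, q), (p', p)) \<in> ?S" "((p', p), (x, v)) \<in> ?S\<^sup>*"
        using chain[OF pq] by blast
      show ?thesis
      proof (cases "r = p")
        case True
        then show ?thesis using p' by (auto simp: X_def)
      next
        case False
        then have "((q, r), (p, q)) \<in> ?S"
          using chain[OF pq] r DD' by (auto simp: white_step_def)
        then show ?thesis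
          using pq unfolding X_def by (blast intro: converse_rtrancl_into_rtrancl)
      qed
    qed
    have vX: "N v - D' \<subseteq> X"
    proof
      fix q assume q: "q \<in> N v - D'"
      then have "((v, q), (x, v)) \<in> ?S"
        using v xD DD' by (auto simp: white_step_def D'_def)
      then show "q \<in> X" unfolding X_def by blast
    qed
    have guard_X: "g w \<notin> X" if w: "w \<in> A" for w
    proof
      assume "g w \<in> X"
      then obtain p where p: "((p, g w), (x, v)) \<in> ?S\<^sup>*" by (auto simp: X_def)
      have "g w \<notin> N x"
        using guard_not_adjacent[OF val w xN(1,2) uy(1) xD] by auto
      then obtain p' where p': "((p, g w), (p', p)) \<in> ?S"
        using chain[OF p] by blast
      obtain l where l: "N l = {g w}" "N (g w) - D = {l}"
        using guard[OF w] by blast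
      have "p = l"
        using l(2) chain[OF p] nbs_sym by blast
      then show False
        using p' l(1) nbs_sym[of p' p] by (auto simp: white_step_def)
    qed
    have vD': "v \<in> D'" using v by (auto simp: D'_def)
    have "\<not> center D v" using X_center by (auto simp: X_def)
    have "valid D' A (insert v B) g (Z \<union> X)"
      unfolding valid_def
    proof (intro conjI ballI)
      show "A \<subseteq> D'" "insert v B \<subseteq> D'" "A \<inter> insert v B = {}" "inj_on g A"
        using AD BD AB inj DD' vD' v by auto
    next
      fix w assume w: "w \<in> A"
      show "g w \<in> N w" "g w \<notin> D'" "g w \<notin> Z \<union> X"
          "\<exists>y. y \<notin> D' \<and> N y = {g w} \<and> N (g w) - D' = {y}"
        using guard[OF w] guard_X[OF w] guards_kept[OF w xD xN(1,2) uy(1)] by (auto simp: D'_def)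
    next
      fix c assume "c \<in> insert v B"
      then show "N c - D' \<subseteq> Z \<union> X"
        using vX B[of c] DD' by auto
    next
      fix a assume a: "a \<in> Z \<union> X - D'"
      then show "\<not> center D' a"
        using X_center Z(1) DD' center_antimono[OF _ DD'] by blast
      show "N a - D' \<subseteq> Z \<union> X"
        using a X_closed Z(2)[of a] DD' by blast
    next
      fix w assume "w \<in> A \<union> insert v B"
      then show "\<not> center D' w"
        using nc \<open>\<not> center D v\<close> center_antimono[OF _ DD'] by blast
    qed
    moreover have "potential (A \<union> insert v B) D' + 7 \<le> potential (A \<union> B) D"
    proof -
      have "potential (A \<union> insert v B) D' + sum (\<lambda>t. if t = v then 1 else 3) {x, y, v} \<le> potential (A \<union> B) D"
      proof (rule potential_drop[OF DD'])
        fix t assume t: "t \<in> {x, y, v}"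
        have "t \<notin> A \<union> B" "t \<notin> D" using t xD y v AD BD by auto
        then have "weight (A \<union> B) D t = 3" by (intro weight_simps)
        moreover have "weight (A \<union> insert v B) D' t = 0" if "t \<noteq> v"
          using t that y xN by (intro weight_simps) (auto simp: D'_def)
        moreover have "weight (A \<union> insert v B) D' v \<le> 2"
          by (intro weight_simps) auto
        ultimately show "weight (A \<union> insert v B) D' t + (if t = v then 1 else 3) \<le> weight (A \<union> B) D t"
          by auto
      qed (use inV v nbs_in_verts in auto)
      moreover have "x \<noteq> y" "x \<noteq> v" using xN v nbs_irrefl by auto
      ultimately show ?thesis using v by simp
    qed
    moreover have "x \<in> legal_moves G D"
      using xD inV by (simp add: legal_moves_iff)
    ultimately show ?thesis
      unfolding D'_def by blast
  next
    case True
    define D' where "D' = play D x\<^sub>1"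
    have DD': "D \<subseteq> D'" by (auto simp: D'_def)
    define g' where "g' = g(u := x)"
    have uA: "u \<notin> A" "u \<notin> B" using u AD BD by auto
    have uD': "u \<in> D'" using xN by (auto simp: D'_def)
    have xD': "x \<notin> D'"
    proof -
      have "x\<^sub>1 \<notin> N x"
      proof
        assume "x\<^sub>1 \<in> N x"
        then have "x\<^sub>1 \<in> {u, y}" using x\<^sub>1D unfolding True[symmetric] by simp
        moreover have "x\<^sub>1 \<noteq> u" using x\<^sub>1 nbs_irrefl by auto
        ultimately have "x\<^sub>1 = y" by simp
        then show False using x\<^sub>1 y x nbs_irrefl nbs_sym by (metis singletonD)
      qed
      then show ?thesis using xD x\<^sub>1 nbs_sym by (auto simp: D'_def)
    qed
    have yD': "y \<notin> D'"
    proof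
      assume "y \<in> D'"
      then consider "y = x\<^sub>1" | "x\<^sub>1 \<in> N y" using y nbs_sym by (auto simp: D'_def)
      then show False
      proof cases
        case 1
        then show False using x\<^sub>1 x y nbs_irrefl nbs_sym by (metis singletonD)
      next
        case 2
        then show False using x\<^sub>1 y by simp
      qed
    qed
    have guard_x: "g w \<noteq> x" if "w \<in> A" for w
      using guard_not_adjacent[OF val that xN(1,2) uy(1) xD] by auto
    have uc: "\<not> center D' u"
      using u x\<^sub>1 DD' by (intro center_killed[of D u x\<^sub>1]) (auto simp: D'_def)
    have "x \<notin> Z"
      using Z u xN xD by blast
    have "valid D' (insert u A) B g' Z"
      unfolding valid_def
    proof (intro conjI ballI)
      show "insert u A \<subseteq> D'" "B \<subseteq> D'" "insert u A \<inter> B = {}"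
        using AD BD AB DD' uD' uA by auto
      show "inj_on g' (insert u A)"
        using inj guard_x uA by (auto simp: g'_def inj_on_def)
    next
      fix w assume w: "w \<in> insert u A"
      have "g' w \<in> N w \<and> g' w \<notin> D' \<and> g' w \<notin> Z \<and> (\<exists>y. y \<notin> D' \<and> N y = {g' w} \<and> N (g' w) - D' = {y})"
      proof (cases "w = u")
        case True
        have "N x - D' = (N x - D) - D'" using DD' by blast
        also have "\<dots> = {y}"
          unfolding \<open>N x - D = {u, y}\<close> using uD' yD' by auto
        finally have "N x - D' = {y}" .
        then show ?thesis
          using True xD' yD' y x \<open>x \<notin> Z\<close> by (auto simp: g'_def)
      next
        case False
        then have w: "w \<in> A" using w by auto
        show ?thesis
          using False guard[OF w] guards_kept[OF w x\<^sub>1D xN(3,4) uy(2)] by (auto simp: g'_def D'_def)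
      qed
      then show "g' w \<in> N w" "g' w \<notin> D'" "g' w \<notin> Z"
          "\<exists>y. y \<notin> D' \<and> N y = {g' w} \<and> N (g' w) - D' = {y}"
        by auto
    next
      fix c assume "c \<in> B"
      then show "N c - D' \<subseteq> Z"
        using B[of c] DD' by auto
    next
      fix a assume a: "a \<in> Z - D'"
      then show "\<not> center D' a"
        using Z(1) DD' center_antimono[OF _ DD'] by blast
      show "N a - D' \<subseteq> Z"
        using a Z(2)[of a] DD' by blast
    next
      fix w assume "w \<in> insert u A \<union> B"
      then show "\<not> center D' w"
        using nc uc center_antimono[OF _ DD'] by blast
    qed
    moreover have "potential (insert u A \<union> B) D' + 7 \<le> potential (A \<union> B) D"
    proof -
      have "potential (insert u A \<union> B) D' + sum (\<lambda>t. if t = u then 1 else 3) {x\<^sub>1, y\<^sub>1, u} \<le> potential (A \<union> B) D"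
      proof (rule potential_drop[OF DD'])
        fix t assume t: "t \<in> {x\<^sub>1, y\<^sub>1, u}"
        have "t \<notin> A \<union> B" "t \<notin> D" using t x\<^sub>1D y\<^sub>1 u AD BD by auto
        then have "weight (A \<union> B) D t = 3" by (intro weight_simps)
        moreover have "weight (insert u A \<union> B) D' t = 0" if "t \<noteq> u"
          using t that y\<^sub>1 xN by (intro weight_simps) (auto simp: D'_def)
        moreover have "weight (insert u A \<union> B) D' u \<le> 2"
          by (intro weight_simps) auto
        ultimately show "weight (insert u A \<union> B) D' t + (if t = u then 1 else 3) \<le> weight (A \<union> B) D t"
          by auto
      qed (use inV in auto)
      moreover have "x\<^sub>1 \<noteq> y\<^sub>1" "x\<^sub>1 \<noteq> u" using xN nbs_irrefl by auto
      ultimately show ?thesis using uy by simp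
    qed
    moreover have "x\<^sub>1 \<in> legal_moves G D"
      using x\<^sub>1D inV by (simp add: legal_moves_iff)
    ultimately show ?thesis
      unfolding D'_def by blast
  qed
qed


section \<open>Dominator's moves when no white center is left\<close>

definition light :: "'a set \<Rightarrow> 'a set" where
  "light D = {c \<in> D. \<not> center D c}"

lemma light_mono: "D \<subseteq> D' \<Longrightarrow> light D \<subseteq> light D'"
  using center_antimono by (auto simp: light_def)

text \<open>
  Without white centers, the region of all vertices is admissible and no guards are needed.
\<close>
lemma valid_light:
  assumes "\<And>u. u \<notin> D \<Longrightarrow> \<not> center D u"
  shows "valid D {} (light D) g UNIV"
  using assms by (auto simp: valid_def light_def)

lemma potential_light_le:
  assumes "valid D A B g Z"
  shows "potential (light D) D \<le> potential (A \<union> B) D"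
proof -
  have "A \<union> B \<subseteq> light D"
    using assms unfolding valid_def light_def by blast
  then show ?thesis
    using potential_drop[of D D "A \<union> B" "light D" "{}" "\<lambda>_. 0"] by simp
qed

text \<open>
  An end of a white tree with at least three vertices has a white neighbour v with another white
  neighbour w. Playing v makes v and the end red and w light.
\<close>
lemma dominator_step_white_path:
  assumes nc: "\<And>u. u \<notin> D \<Longrightarrow> \<not> center D u"
    and "v\<^sub>0 \<notin> D" "a \<in> N v\<^sub>0 - D" "b \<in> N v\<^sub>0 - D" "a \<noteq> b"
  shows "\<exists>z \<in> legal_moves G D. potential (light (play D z)) (play D z) + 7 \<le> potential (light D) D"
proof -
  define Q where "Q = {(w, v). w \<notin> D \<and> v \<in> N w - D \<and> (\<exists>u \<in> N v - D. u \<noteq> w)}"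
  have "(a, v\<^sub>0) \<in> Q"
    using assms nbs_sym[of v\<^sub>0 a] unfolding Q_def by (auto intro!: bexI[of _ b])
  then obtain w v where Q: "(w, v) \<in> Q" and min: "\<And>z. (z, (w, v)) \<in> white_step D \<Longrightarrow> z \<notin> Q"
    using wf_white_step[of D] unfolding wf_eq_minimal by (metis surj_pair)
  from Q obtain u where u: "u \<in> N v - D" "u \<noteq> w" and w: "w \<notin> D" "v \<in> N w - D"
    by (auto simp: Q_def)
  have "((v, u), (w, v)) \<in> white_step D"
    using u w by (auto simp: white_step_def)
  then have "(v, u) \<notin> Q" by (rule min)
  then have Nu: "N u - D \<subseteq> {v}"
    using u w unfolding Q_def by blast
  let ?D' = "play D v"
  have ne: "v \<noteq> u" "v \<noteq> w" using u w nbs_irrefl by auto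
  have "w \<in> N v" using w nbs_sym by auto
  have inV: "v \<in> V" "u \<in> V" "w \<in> V" using u \<open>w \<in> N v\<close> nbs_in_verts by blast+
  have "potential (light ?D') ?D' + sum (\<lambda>t. if t = w then 1 else 3) {v, u, w} \<le> potential (light D) D"
  proof (rule potential_drop)
    show "light D \<subseteq> light ?D'" by (rule light_mono) auto
  next
    fix t assume t: "t \<in> {v, u, w}"
    then have "weight (light D) D t = 3"
      using u w by (intro weight_simps) (auto simp: light_def)
    moreover have "weight (light ?D') ?D' t = 0" if "t \<noteq> w"
      using t that Nu u by (intro weight_simps) auto
    moreover have "\<not> center ?D' w"
      using nc[OF w(1)] center_antimono by blast
    then have "weight (light ?D') ?D' w \<le> 2"
      using \<open>w \<in> N v\<close> by (intro weight_simps) (auto simp: light_def)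
    ultimately show "weight (light ?D') ?D' t + (if t = w then 1 else 3) \<le> weight (light D) D t"
      by auto
  qed (use inV in auto)
  moreover have "v \<in> legal_moves G D"
    using inV w by (simp add: legal_moves_iff)
  ultimately show ?thesis
    using ne u by (intro bexI[of _ v]) auto
qed

text \<open>
  A blue center weighs 3. Playing one of its two supports makes it light, besides turning the
  support and its leaf red.
\<close>
lemma dominator_step_dominated_center:
  assumes "c \<in> D" "center D c"
  shows "\<exists>z \<in> legal_moves G D. potential (light (play D z)) (play D z) + 7 \<le> potential (light D) D"
proof -
  obtain x where x: "x \<in> N c" "support D x"
    using assms by (auto simp: center_def)
  obtain y where y: "y \<notin> D" "N y = {x}" and xD: "x \<notin> D"
    using x by (auto simp: support_def)
  let ?D' = "play D x"
  have xN: "c \<in> N x" "y \<in> N x" using x y nbs_sym by auto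
  have inV: "x \<in> V" "y \<in> V" "c \<in> V" using xN nbs_in_verts by blast+
  have ne: "x \<noteq> y" "x \<noteq> c" "y \<noteq> c" using xN nbs_irrefl assms y by auto
  have "\<not> center ?D' c"
    using assms x by (intro center_killed[of D c x]) auto
  then have c: "weight (light ?D') ?D' c \<le> 2"
    using assms by (intro weight_simps) (auto simp: light_def)
  have "potential (light ?D') ?D' + sum (\<lambda>t. if t = c then 1 else 3) {x, y, c} \<le> potential (light D) D"
  proof (rule potential_drop)
    show "light D \<subseteq> light ?D'" by (rule light_mono) auto
  next
    fix t assume t: "t \<in> {x, y, c}"
    then have "weight (light D) D t = 3"
      using assms x xD y by (auto simp: light_def weight_def)
    moreover have "weight (light ?D') ?D' t = 0" if "t \<noteq> c"
      using t that y xN by (intro weight_simps) auto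
    ultimately show "weight (light ?D') ?D' t + (if t = c then 1 else 3) \<le> weight (light D) D t"
      using c by auto
  qed (use inV in auto)
  moreover have "x \<in> legal_moves G D"
    using inV xD by (simp add: legal_moves_iff)
  ultimately show ?thesis
    using ne by (intro bexI[of _ x]) auto
qed

abbreviation \<phi> :: "'a set \<Rightarrow> int" where "\<phi> D \<equiv> potential D D"

text \<open>
  The form in which the cost of moves is computed when all blue vertices are light: R and R' are
  white and blue vertices that become red, and S are further white vertices that become dominated.
\<close>
lemma phi_gain:
  assumes "D \<subseteq> D'" "R \<subseteq> V - D" "R' \<subseteq> V \<inter> D" "S \<subseteq> V - D" "R \<inter> S = {}"
    and red: "\<And>t. t \<in> R \<union> R' \<Longrightarrow> insert t (N t) \<subseteq> D'"
    and "\<And>t. t \<in> R' \<Longrightarrow> \<not> N t \<subseteq> D" and "S \<subseteq> D'"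
  shows "\<phi> D' + (3 * card R + 2 * card R' + card S) \<le> \<phi> D"
proof -
  have fin: "finite R" "finite R'" "finite S"
    using assms(2-4) finite_verts finite_subset by blast+
  define k :: "'a \<Rightarrow> int" where "k t = (if t \<in> R then 3 else if t \<in> R' then 2 else 1)" for t
  have "\<phi> D' + sum k (R \<union> R' \<union> S) \<le> \<phi> D"
  proof (rule potential_drop)
    fix t assume t: "t \<in> R \<union> R' \<union> S"
    show "weight D' D' t + k t \<le> weight D D t"
      using assms t red[of t] by (auto simp: weight_def k_def)
  qed (use assms in auto)
  moreover have disj: "R \<inter> R' = {}" "(R \<union> R') \<inter> S = {}"
    using assms by auto
  then have "sum k (R \<union> R' \<union> S) = sum k R + sum k R' + sum k S"
    using fin by (simp add: sum.union_disjoint)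
  moreover have "sum k R = (\<Sum>t \<in> R. 3)" "sum k R' = (\<Sum>t \<in> R'. 2)" "sum k S = (\<Sum>t \<in> S. 1)"
    using disj by (intro sum.cong; auto simp: k_def)+
  ultimately show ?thesis by simp
qed

text \<open>
  The white graph has maximum degree at most 1. As there are no centers, all blue vertices may be
  light, and the cost of moves is taken with respect to that labelling.
\<close>
definition greedy_exhausted :: "'a set \<Rightarrow> bool" where
  "greedy_exhausted D \<longleftrightarrow> (\<forall>v. \<not> center D v) \<and> (\<forall>v a b. v \<notin> D \<longrightarrow> a \<in> N v - D \<longrightarrow> b \<in> N v - D \<longrightarrow> a = b) \<and>
    (\<forall>z \<in> V. \<phi> D < \<phi> (play D z) + 7)"

lemma dominator_dichotomy:
  assumes val: "valid D A B g Z"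
  shows "(\<exists>x \<in> legal_moves G D. \<exists>A' B' g' Z'. valid (play D x) A' B' g' Z' \<and>
      potential (A' \<union> B') (play D x) + 7 \<le> potential (A \<union> B) D) \<or>
    (greedy_exhausted D \<and> \<phi> D \<le> potential (A \<union> B) D)"
proof (cases "\<exists>u. u \<notin> D \<and> center D u")
  case True
  then show ?thesis using dominator_step_center[OF val] by blast
next
  case False
  have val': "valid (play D x) {} (light (play D x)) g UNIV" for x
    using False center_antimono[of "play D x" _ D] by (intro valid_light) blast
  have le: "potential (light D) D \<le> potential (A \<union> B) D"
    using val by (rule potential_light_le)
  show ?thesis
  proof (cases "\<exists>z \<in> legal_moves G D. potential (light (play D z)) (play D z) + 7 \<le> potential (light D) D")
    case True
    then obtain z where z: "z \<in> legal_moves G D" "potential (light (play D z)) (play D z) + 7 \<le> potential (light D) D"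
      by blast
    then have "potential ({} \<union> light (play D z)) (play D z) + 7 \<le> potential (A \<union> B) D"
      using le by simp
    then show ?thesis using z(1) val' by blast
  next
    case no7: False
    have nc: "\<not> center D v" for v
      using False no7 dominator_step_dominated_center by blast
    then have light: "light D' = D'" if "D \<subseteq> D'" for D'
      using center_antimono[OF _ that] by (auto simp: light_def)
    have "greedy_exhausted D"
      unfolding greedy_exhausted_def
    proof (intro conjI allI impI ballI)
      fix v a b assume "v \<notin> D" "a \<in> N v - D" "b \<in> N v - D"
      then show "a = b"
        using no7 nc dominator_step_white_path by blast
    next
      fix z assume z: "z \<in> V"
      show "\<phi> D < \<phi> (play D z) + 7"
      proof (cases "z \<in> legal_moves G D")
        case True
        then show ?thesis using no7 light[of D] light[of "play D z"] by force
      next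
        case False
        then have "play D z = D" using z by (auto simp: legal_moves_iff)
        then show ?thesis by simp
      qed
    qed (use nc in blast)
    then show ?thesis using le light[of D] by simp
  qed
qed

text \<open>
  A closed walk that never turns back would make one of its arcs smaller than itself.
\<close>
lemma no_closed_walk5:
  assumes "b \<in> N a" "c \<in> N b" "d \<in> N c" "e \<in> N d" "a \<in> N e"
    and "c \<noteq> a" "d \<noteq> b" "e \<noteq> c" "a \<noteq> d" "b \<noteq> e"
  shows False
proof -
  let ?S = "white_step {}"
  have "((b, c), (a, b)) \<in> ?S" "((c, d), (b, c)) \<in> ?S" "((d, e), (c, d)) \<in> ?S"
    "((e, a), (d, e)) \<in> ?S" "((a, b), (e, a)) \<in> ?S"
    using assms by (auto simp: white_step_def)
  then have "((a, b), (a, b)) \<in> ?S\<^sup>+"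
    by (meson trancl.intros)
  then show False
    using wf_white_step wf_acyclic by (auto simp: acyclic_def)
qed

lemma no_closed_walk6:
  assumes "b \<in> N a" "c \<in> N b" "d \<in> N c" "e \<in> N d" "f \<in> N e" "a \<in> N f"
    and "c \<noteq> a" "d \<noteq> b" "e \<noteq> c" "f \<noteq> d" "a \<noteq> e" "b \<noteq> f"
  shows False
proof -
  let ?S = "white_step {}"
  have "((b, c), (a, b)) \<in> ?S" "((c, d), (b, c)) \<in> ?S" "((d, e), (c, d)) \<in> ?S"
    "((e, f), (d, e)) \<in> ?S" "((f, a), (e, f)) \<in> ?S" "((a, b), (f, a)) \<in> ?S"
    using assms by (auto simp: white_step_def)
  then have "((a, b), (a, b)) \<in> ?S\<^sup>+"
    by (meson trancl.intros)
  then show False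
    using wf_white_step wf_acyclic by (auto simp: acyclic_def)
qed


section \<open>Positions without a move of cost 7\<close>

lemma play_white_edge:
  assumes "greedy_exhausted D" "x \<notin> D" "y \<notin> D" "y \<in> N x"
  shows "play D x = D \<union> {x, y}" and "N x - D = {y}" and "N y - D = {x}"
proof -
  have "x \<in> N y" using assms nbs_sym by auto
  then show "N x - D = {y}" "N y - D = {x}"
    using assms unfolding greedy_exhausted_def by blast+
  then show "play D x = D \<union> {x, y}" by blast
qed

lemma white_edge_gain:
  assumes "greedy_exhausted D" "x \<notin> D" "y \<notin> D" "y \<in> N x"
  shows "\<phi> (play D x) + 6 \<le> \<phi> D"
proof -
  have "x \<in> V" "y \<in> V" "x \<noteq> y" using assms nbs_in_verts nbs_irrefl by auto
  have "\<phi> (play D x) + (3 * card {x, y} + 2 * card ({} :: 'a set) + card ({} :: 'a set)) \<le> \<phi> D"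
    using assms play_white_edge[OF assms] \<open>x \<in> V\<close> \<open>y \<in> V\<close> by (intro phi_gain) auto
  then show ?thesis using \<open>x \<noteq> y\<close> by simp
qed

text \<open>
  Dominator has played x, so that x and its white partner y are red. A reply z of cost 3 is either
  a white vertex without white neighbours, or a blue vertex that dominates exactly one end r of
  another white edge rs.

  In the first case z has a blue neighbour b, and b has exactly one other white neighbour r, which
  lies on a white edge: otherwise the reply would cost 5, or b would have been a move of cost at
  least 7. Now playing r turns that edge and b red, at a cost of 8.

  In the second case z is adjacent to x or y, for otherwise r would have been a move of cost 8. If
  s is a leaf, then so is y by the choice of the edge xy, and z would be a center with the supports
  x and r. So s has another neighbour c, which is blue. If c has a white neighbour other than s,
  then playing c costs 8: 3 at s, 2 at each of c and r, and 1 at that neighbour. If it has none,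
  then by acyclicity it had none before x was played either, and s would have been a move of
  cost 8.
\<close>
lemma staller_reply:
  assumes ex: "greedy_exhausted D" and x: "x \<notin> D" and y: "y \<notin> D" "y \<in> N x"
    and leaf_edge: "N y = {x} \<or> (\<forall>r s. r \<notin> D \<longrightarrow> s \<notin> D \<longrightarrow> N s \<noteq> {r})"
    and z: "z \<in> legal_moves G (play D x)"
  shows "\<phi> (play (play D x) z) + 10 \<le> \<phi> D \<or> \<phi> (play (play D x) z) + 9 \<le> \<phi> D \<and>
      (\<exists>t \<in> legal_moves G (play (play D x) z). \<phi> (play (play (play D x) z) t) + 17 \<le> \<phi> D)" (is ?B)
proof -
  define D\<^sub>1 where "D\<^sub>1 = play D x"
  define D\<^sub>2 where "D\<^sub>2 = play D\<^sub>1 z"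
  have nc: "\<not> center D v" for v
    using ex by (simp add: greedy_exhausted_def)
  have deg: "a = b" if "v \<notin> D" "a \<in> N v - D" "b \<in> N v - D" for v a b
    using ex that unfolding greedy_exhausted_def by blast
  have no7: "\<not> \<phi> (play D t) + 7 \<le> \<phi> D" if "t \<in> V" for t
    using ex that unfolding greedy_exhausted_def by (simp add: not_le)
  note edge = play_white_edge[OF ex]
  have D1: "D\<^sub>1 = D \<union> {x, y}" and Nx: "N x - D = {y}" and Ny: "N y - D = {x}"
    using edge x y by (auto simp: D\<^sub>1_def)
  have xy: "x \<in> V" "y \<in> V" "x \<noteq> y" using y nbs_in_verts nbs_irrefl by auto
  have DD1: "D \<subseteq> D\<^sub>1" and D12: "D\<^sub>1 \<subseteq> D\<^sub>2" by (auto simp: D1 D\<^sub>2_def)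
  have gain1: "\<phi> D\<^sub>1 + 6 \<le> \<phi> D"
    using white_edge_gain[OF ex x y] by (simp add: D\<^sub>1_def)
  have zV: "z \<in> V" and zleg: "\<not> insert z (N z) \<subseteq> D\<^sub>1"
    using z by (auto simp: legal_moves_iff D\<^sub>1_def)
  have goal4: ?B if "\<phi> D\<^sub>2 + 4 \<le> \<phi> D\<^sub>1"
    using that gain1 by (simp add: D\<^sub>2_def D\<^sub>1_def)
  have goal8: ?B if "\<phi> D\<^sub>2 + 3 \<le> \<phi> D\<^sub>1" "t \<in> V" "t \<notin> D\<^sub>2 \<or> (\<exists>s \<in> N t. s \<notin> D\<^sub>2)" "\<phi> (play D\<^sub>2 t) + 8 \<le> \<phi> D\<^sub>2" for t
  proof -
    have "t \<in> legal_moves G D\<^sub>2" using that by (auto simp: legal_moves_iff)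
    then show ?thesis using that gain1 by (auto simp: D\<^sub>2_def D\<^sub>1_def intro!: bexI[of _ t])
  qed
  show ?B
  proof (cases "z \<in> D\<^sub>1")
    case False
    then have zD: "z \<notin> D" by (auto simp: D1)
    show ?thesis
    proof (cases "N z \<subseteq> D")
      case False
      then obtain a where a: "a \<in> N z" "a \<notin> D" by auto
      then have az: "a \<noteq> x" "a \<noteq> y"
        using Nx Ny zD \<open>z \<notin> D\<^sub>1\<close> nbs_sym unfolding D1 by blast+
      have "N z - D = {a}" "N a - D = {z}" using edge[OF zD a(2,1)] by auto
      then have "\<phi> D\<^sub>2 + (3 * card {z} + 2 * card ({} :: 'a set) + card {a}) \<le> \<phi> D\<^sub>1"
        using D12 zV a az \<open>z \<notin> D\<^sub>1\<close> nbs_in_verts nbs_irrefl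
        by (intro phi_gain) (auto simp: D1 D\<^sub>2_def)
      then show ?thesis by (intro goal4) simp
    next
      case Nz: True
      have D2: "D\<^sub>2 = D\<^sub>1 \<union> {z}" using Nz by (auto simp: D\<^sub>2_def D1)
      obtain b where b: "b \<in> N z" using nbs_nonempty zV by blast
      then have bD: "b \<in> D" and zb: "z \<in> N b" and bV: "b \<in> V"
        using Nz nbs_sym nbs_in_verts by auto
      have bz: "b \<noteq> z" using bD zD by auto
      show ?thesis
      proof (cases "N b - D\<^sub>1 \<subseteq> {z}")
        case True
        then have "\<phi> D\<^sub>2 + (3 * card {z} + 2 * card {b} + card ({} :: 'a set)) \<le> \<phi> D\<^sub>1"
          using D12 zV bV bD zb Nz \<open>z \<notin> D\<^sub>1\<close> by (intro phi_gain) (auto simp: D1 D2)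
        then show ?thesis by (intro goal4) simp
      next
        case False
        then obtain r where r: "r \<in> N b" "r \<notin> D\<^sub>1" "r \<noteq> z" by auto
        then have rD: "r \<notin> D" and rV: "r \<in> V" using nbs_in_verts by (auto simp: D1)
        show ?thesis
        proof (cases "N r \<subseteq> D")
          case True
          then have "\<phi> (play D b) + (3 * card {z, r} + 2 * card {b} + card ({} :: 'a set)) \<le> \<phi> D"
            using zV rV bV zD rD bD Nz zb r(1) by (intro phi_gain) auto
          then show ?thesis using no7[OF bV] r by simp
        next
          case False
          then obtain s where s: "s \<in> N r" "s \<notin> D" by auto
          have Nr: "N r - D = {s}" and Ns: "N s - D = {r}" using edge[OF rD s(2,1)] by auto
          have rz: "z \<noteq> s" "z \<notin> N r" "z \<notin> N s"
          proof -
            show "z \<notin> N r" using Nz rD nbs_sym[of z r] by auto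
            then show "z \<noteq> s" using s(1) by auto
            show "z \<notin> N s" using Ns zD r(3) by auto
          qed
          have rs: "r \<noteq> s" "s \<in> V" using s nbs_irrefl nbs_in_verts by auto
          have Nb: "N b - D = {z, r}"
          proof (rule ccontr)
            assume "N b - D \<noteq> {z, r}"
            then obtain w where w: "w \<in> N b" "w \<notin> D" "w \<noteq> z" "w \<noteq> r"
              using zb zD r rD by blast
            then have "\<phi> (play D b) + (3 * card {z} + 2 * card {b} + card {r, w}) \<le> \<phi> D"
              using zV rV bV zD rD bD Nz zb r nbs_in_verts by (intro phi_gain) auto
            then show False using no7[OF bV] w by simp
          qed
          have sxy: "s \<notin> D\<^sub>1" "r \<notin> D\<^sub>2" "s \<notin> D\<^sub>2"
          proof -
            show "s \<notin> D\<^sub>1"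
              using Ns Nx Ny r(2) s(2) unfolding D1 by auto
            then show "r \<notin> D\<^sub>2" "s \<notin> D\<^sub>2"
              using r rz by (auto simp: D2)
          qed
          have gain2: "\<phi> D\<^sub>2 + (3 * card {z} + 2 * card ({} :: 'a set) + card ({} :: 'a set)) \<le> \<phi> D\<^sub>1"
            using D12 zV Nz \<open>z \<notin> D\<^sub>1\<close> by (intro phi_gain) (auto simp: D1 D2)
          have gain3: "\<phi> (play D\<^sub>2 r) + (3 * card {r, s} + 2 * card {b} + card ({} :: 'a set)) \<le> \<phi> D\<^sub>2"
          proof (rule phi_gain)
            have "N r \<subseteq> D \<union> {s}" "N s \<subseteq> D \<union> {r}" "N b \<subseteq> D \<union> {z, r}"
              using Nr Ns Nb by auto
            then show "\<And>t. t \<in> {r, s} \<union> {b} \<Longrightarrow> insert t (N t) \<subseteq> play D\<^sub>2 r"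
              using s(1) bD unfolding D2 D1 by blast
          qed (use rV rs bV bD sxy r(1) DD1 D12 in auto)
          show ?thesis
            using gain2 gain3 rs sxy rV by (intro goal8[of r]) auto
        qed
      qed
    qed
  next
    case True
    have zD: "z \<in> D"
      using True zleg Nx Ny x y nbs_sym unfolding D1 by blast
    obtain r where r: "r \<in> N z" "r \<notin> D\<^sub>1"
      using zleg True by auto
    have rD: "r \<notin> D" and rV: "r \<in> V" using r DD1 nbs_in_verts by auto
    have rz: "r \<noteq> z" "z \<in> N r" using r True nbs_sym by auto
    have r_white: "N r - D \<subseteq> V - D\<^sub>1"
      using Nx Ny r(2) rD nbs_sym nbs_in_verts unfolding D1 by blast
    show ?thesis
    proof (cases "N z - D\<^sub>1 = {r}")
      case False
      then obtain r' where r': "r' \<in> N z" "r' \<notin> D\<^sub>1" "r' \<noteq> r" using r by blast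
      have "\<phi> D\<^sub>2 + (3 * card ({} :: 'a set) + 2 * card {z} + card {r, r'}) \<le> \<phi> D\<^sub>1"
        using D12 zV True r r' nbs_in_verts by (intro phi_gain) (auto simp: D\<^sub>2_def)
      then show ?thesis using r' by (intro goal4) simp
    next
      case Nz: True
      then have D2: "D\<^sub>2 = D\<^sub>1 \<union> {r}" using True by (auto simp: D\<^sub>2_def)
      show ?thesis
      proof (cases "N r \<subseteq> D")
        case True
        then have "\<phi> D\<^sub>2 + (3 * card {r} + 2 * card {z} + card ({} :: 'a set)) \<le> \<phi> D\<^sub>1"
          using D12 zV \<open>z \<in> D\<^sub>1\<close> r rV Nz DD1 by (intro phi_gain) (auto simp: D2)
        then show ?thesis by (intro goal4) simp
      next
        case False
        then obtain s where s: "s \<in> N r" "s \<notin> D" by auto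
        have Nr: "N r - D = {s}" and Ns: "N s - D = {r}" using edge[OF rD s(2,1)] by auto
        have sV: "s \<in> V" and rs: "r \<noteq> s" "r \<in> N s" using s nbs_irrefl nbs_in_verts nbs_sym by auto
        have sD1: "s \<notin> D\<^sub>1" using r_white s by auto
        then have sD2: "s \<notin> D\<^sub>2" using rs by (auto simp: D2)
        have gain2: "\<phi> D\<^sub>2 + (3 * card ({} :: 'a set) + 2 * card {z} + card {r}) \<le> \<phi> D\<^sub>1"
          using D12 zV \<open>z \<in> D\<^sub>1\<close> r rV Nz DD1 by (intro phi_gain) (auto simp: D2)
        obtain e where e: "e \<in> {x, y}" "e \<in> N z"
        proof (rule ccontr)
          assume "\<not> thesis"
          then have "N z \<subseteq> D \<union> {r}" using Nz that by (auto simp: D1)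
          moreover have "N r \<subseteq> D \<union> {s}" "N s \<subseteq> D \<union> {r}" using Nr Ns by auto
          ultimately have "\<phi> (play D r) + (3 * card {r, s} + 2 * card {z} + card ({} :: 'a set)) \<le> \<phi> D"
            using rV sV zV rD s zD r by (intro phi_gain) auto
          then show False using no7[OF rV] rs by simp
        qed
        have "N s \<noteq> {r}"
        proof
          assume "N s = {r}"
          then have "N y = {x}" using leaf_edge rD s by blast
          moreover have "z \<noteq> x" using zD x by auto
          ultimately have "x \<in> N z" using e nbs_sym[of y z] by auto
          moreover have "support D x" "support D r"
            using \<open>N y = {x}\<close> \<open>N s = {r}\<close> x y rD s by (auto simp: support_def)
          moreover have "x \<noteq> r" using r(2) by (auto simp: D1)
          ultimately show False using nc[of z] r(1) unfolding center_def by blast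
        qed
        \<comment> \<open>r is now a blue vertex with s as its only white neighbour, so a move at c turns r, s and c
          red.\<close>
        then obtain c where c: "c \<in> N s" "c \<noteq> r" using rs by blast
        have cD: "c \<in> D" and cV: "c \<in> V" and sc: "s \<in> N c" using c Ns nbs_in_verts nbs_sym by auto
        have rc: "r \<notin> N c" using no_triangle[OF acyclic_graph, of s c r] sc rs(2) nbs_sym[of c r] by auto
        show ?thesis
        proof (cases "N c - D\<^sub>2 \<subseteq> {s}")
          case False
          then obtain w where w: "w \<in> N c" "w \<notin> D\<^sub>2" "w \<noteq> s" by blast
          have "\<phi> (play D\<^sub>2 c) + (3 * card {s} + 2 * card {c, r} + card {w}) \<le> \<phi> D\<^sub>2"
          proof (rule phi_gain)
            have "N r \<subseteq> D \<union> {s}" "N s \<subseteq> D \<union> {r}" using Nr Ns by auto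
            then show "\<And>t. t \<in> {s} \<union> {c, r} \<Longrightarrow> insert t (N t) \<subseteq> play D\<^sub>2 c"
              using sc cD unfolding D2 D1 by blast
          qed (use rV rs sV sD2 cV cD w r(1) DD1 D12 D2 sc s nbs_in_verts in auto)
          then show ?thesis
            using gain2 c cV sc sD2 by (intro goal8[of c]) auto
        next
          case True
          have "N c - D \<subseteq> {s, x, y}" using True rc by (auto simp: D1 D2)
          have zc: "z \<noteq> c" using rc r(1) by auto
          \<comment> \<open>An edge from c to x or y would close a cycle through r, s and z.\<close>
          have no_e: "e' \<notin> N c" if e': "e' \<in> {x, y}" for e'
          proof
            assume "e' \<in> N c"
            have ne: "e' \<noteq> s" "e' \<noteq> r" "e \<noteq> r" "e \<noteq> s" using e e' sD1 r(2) by (auto simp: D1)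
            show False
            proof (cases "e' = e")
              case True
              show ?thesis
                by (rule no_closed_walk5[of s r c e z])
                  (use s(1) c sc e zD cD rz \<open>e' \<in> N c\<close> True ne zc s(2) rD r nbs_sym in auto)
            next
              case False
              then have "e \<in> N e'" using e e' y nbs_sym by auto
              show ?thesis
                by (rule no_closed_walk6[of s r c e' e z])
                  (use s(1) c sc e e' x y zD cD rz \<open>e' \<in> N c\<close> \<open>e \<in> N e'\<close> False ne zc s(2) rD r nbs_sym in auto)
            qed
          qed
          then have "N c \<subseteq> D \<union> {s}" using \<open>N c - D \<subseteq> {s, x, y}\<close> by auto
          moreover have "N r \<subseteq> D \<union> {s}" "N s \<subseteq> D \<union> {r}" using Nr Ns by auto
          ultimately have "\<phi> (play D s) + (3 * card {s, r} + 2 * card {c} + card ({} :: 'a set)) \<le> \<phi> D"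
            using rV sV cV rD s cD sc rs by (intro phi_gain) auto
          then show ?thesis using no7[OF sV] rs by simp
        qed
      qed
    qed
  qed
qed


text \<open>
  No blue vertex has two white neighbours here: playing it would make all three red, at a cost
  of 8. So a choice of a neighbour for each white vertex is injective.
\<close>
lemma five_card_undominated_le:
  assumes ex: "greedy_exhausted D" and no_edge: "\<And>v. v \<notin> D \<Longrightarrow> N v \<subseteq> D"
  shows "5 * int (card (V - D)) \<le> \<phi> D"
proof -
  have "\<exists>b. b \<in> N v" if "v \<in> V - D" for v
    using nbs_nonempty that by auto
  then obtain f where f: "f v \<in> N v" if "v \<in> V - D" for v by metis
  have fD: "f v \<in> V \<inter> D" "v \<in> N (f v)" if "v \<in> V - D" for v
    using f[OF that] no_edge[of v] that nbs_in_verts nbs_sym by auto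
  have inj: "inj_on f (V - D)"
  proof (rule inj_onI, rule ccontr)
    fix v w assume vw: "v \<in> V - D" "w \<in> V - D" "f v = f w" "v \<noteq> w"
    have "\<phi> (play D (f v)) + (3 * card {v, w} + 2 * card {f v} + card ({} :: 'a set)) \<le> \<phi> D"
      using vw fD[OF vw(1)] fD[OF vw(2)] no_edge[of v] no_edge[of w] by (intro phi_gain) auto
    then have "\<phi> (play D (f v)) + 7 \<le> \<phi> D" using vw by simp
    then show False
      using ex fD[OF vw(1)] unfolding greedy_exhausted_def by (meson IntD1 not_le)
  qed
  have "sum (weight D D) (V - D) = (\<Sum>v \<in> V - D. 3)"
    by (intro sum.cong weight_simps) auto
  moreover have "sum (weight D D) (f ` (V - D)) = (\<Sum>v \<in> f ` (V - D). 2)"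
  proof (intro sum.cong refl)
    fix b assume "b \<in> f ` (V - D)"
    then obtain v where "v \<in> V - D" "b = f v" by auto
    then show "weight D D b = 2" using fD[of v] by (intro weight_simps(4)[of _ _ v]) auto
  qed
  moreover have "sum (weight D D) ((V - D) \<union> f ` (V - D)) = sum (weight D D) (V - D) + sum (weight D D) (f ` (V - D))"
    using fD by (intro sum.union_disjoint) auto
  moreover have "sum (weight D D) ((V - D) \<union> f ` (V - D)) \<le> \<phi> D"
    unfolding potential_def using fD weight_simps(5) by (intro sum_mono2) auto
  ultimately show ?thesis
    using card_image[OF inj] by simp
qed

lemma potential_nonneg: "potential U D \<ge> 0"
  unfolding potential_def by (intro sum_nonneg weight_simps)

lemma valid_no_centers:
  assumes "greedy_exhausted D" "D \<subseteq> D'"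
  shows "valid D' {} D' g UNIV"
  using assms center_antimono[of D' _ D] unfolding valid_def greedy_exhausted_def by auto

section \<open>The bounds\<close>

text \<open>
  In an exhausted position the induction looks two or three moves ahead. Costs of 6 and 4 pay for
  two moves; costs of 6, 3 and 8 pay for three and leave the 2 units by which the bound is larger
  when Staller is to move, just as a single move of cost 7 does.
\<close>
theorem game_length_bound:
  assumes "valid D A B g Z"
  shows "5 * int (game_length G Dominator D) \<le> potential (A \<union> B) D"
    and "5 * int (game_length G Staller D) \<le> potential (A \<union> B) D + 2"
  using assms
proof (induction "card (V - D)" arbitrary: D A B g Z rule: less_induct)
  case less
  note IH = less.hyps[OF card_play_less]
  {
    case 1
    consider (seven) x A' B' g' Z' where "x \<in> legal_moves G D" "valid (play D x) A' B' g' Z'"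
        "potential (A' \<union> B') (play D x) + 7 \<le> potential (A \<union> B) D"
      | (exhausted) "greedy_exhausted D" "\<phi> D \<le> potential (A \<union> B) D"
      using dominator_dichotomy[OF 1] by blast
    then show ?case
    proof cases
      case seven
      then show ?thesis
        using IH(2)[OF seven(1,2)] game_length_Dominator_le[OF seven(1)] by linarith
    next
      case exhausted
      have "5 * int (game_length G Dominator D) \<le> \<phi> D"
      proof (cases "\<exists>x y. x \<notin> D \<and> y \<notin> D \<and> y \<in> N x")
        case False
        then have "5 * int (card (V - D)) \<le> \<phi> D"
          by (intro five_card_undominated_le[OF exhausted(1)]) blast
        then show ?thesis
          using game_length_le_card[of Dominator D] by linarith
      next
        case True
        \<comment> \<open>A white edge with a leaf as its far end is preferred, if there is one.\<close>
        have "\<exists>x y. x \<notin> D \<and> y \<notin> D \<and> y \<in> N x \<and> (N y = {x} \<or> (\<forall>r s. r \<notin> D \<longrightarrow> s \<notin> D \<longrightarrow> N s \<noteq> {r}))"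
        proof (cases "\<exists>r s. r \<notin> D \<and> s \<notin> D \<and> N s = {r}")
          case True
          then show ?thesis using nbs_sym by (metis singletonI)
        qed (use True in blast)
        then obtain x y where xy: "x \<notin> D" "y \<notin> D" "y \<in> N x"
          "N y = {x} \<or> (\<forall>r s. r \<notin> D \<longrightarrow> s \<notin> D \<longrightarrow> N s \<noteq> {r})" by blast
        let ?D\<^sub>1 = "play D x"
        have x: "x \<in> legal_moves G D" using xy nbs_in_verts by (auto simp: legal_moves_iff)
        have gain1: "\<phi> ?D\<^sub>1 + 6 \<le> \<phi> D"
          using white_edge_gain[OF exhausted(1)] xy by blast
        have "5 * int (game_length G Staller ?D\<^sub>1) + 5 \<le> \<phi> D"
        proof (cases "legal_moves G ?D\<^sub>1 = {}")
          case True
          then show ?thesis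
            using gain1 potential_nonneg[of ?D\<^sub>1 ?D\<^sub>1] by (simp add: game_length_no_moves)
        next
          case False
          then obtain z where z: "z \<in> legal_moves G ?D\<^sub>1"
            and len: "game_length G Staller ?D\<^sub>1 = Suc (game_length G Dominator (play ?D\<^sub>1 z))"
            using game_length_Staller_obtain by blast
          let ?D\<^sub>2 = "play ?D\<^sub>1 z"
          have small2: "card (V - ?D\<^sub>2) < card (V - D)"
            using card_play_less[OF x] card_play_less[OF z] by linarith
          consider "\<phi> ?D\<^sub>2 + 10 \<le> \<phi> D"
            | t where "t \<in> legal_moves G ?D\<^sub>2" "\<phi> (play ?D\<^sub>2 t) + 17 \<le> \<phi> D"
            using staller_reply[OF exhausted(1) xy z] by blast
          then show ?thesis
          proof cases
            case 1
            have "valid ?D\<^sub>2 {} ?D\<^sub>2 id UNIV"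
              by (rule valid_no_centers[OF exhausted(1)]) auto
            from less.hyps(1)[OF small2 this]
            have "5 * int (game_length G Dominator ?D\<^sub>2) \<le> \<phi> ?D\<^sub>2"
              by simp
            then show ?thesis using 1 len by simp
          next
            case (2 t)
            have val: "valid (play ?D\<^sub>2 t) {} (play ?D\<^sub>2 t) id UNIV"
              by (rule valid_no_centers[OF exhausted(1)]) auto
            have "card (V - play ?D\<^sub>2 t) < card (V - D)"
              using small2 card_play_less[OF 2(1)] by linarith
            from less.hyps(2)[OF this val]
            have "5 * int (game_length G Staller (play ?D\<^sub>2 t)) \<le> \<phi> (play ?D\<^sub>2 t) + 2"
              by simp
            then show ?thesis
              using 2(2) len game_length_Dominator_le[OF 2(1)] by simp
          qed
        qed
        then show ?thesis
          using game_length_Dominator_le[OF x] by linarith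
      qed
      then show ?thesis using exhausted(2) by simp
    qed
  next
    case 2
    show ?case
    proof (cases "legal_moves G D = {}")
      case True
      then show ?thesis
        using potential_nonneg[of "A \<union> B" D] by (simp add: game_length_no_moves)
    next
      case False
      then obtain z where z: "z \<in> legal_moves G D"
        and len: "game_length G Staller D = Suc (game_length G Dominator (play D z))"
        using game_length_Staller_obtain by blast
      obtain A' B' Z' where "valid (play D z) A' B' g Z'"
        "potential (A' \<union> B') (play D z) + 3 \<le> potential (A \<union> B) D"
        using staller_step[OF 2 z] by blast
      then show ?thesis
        using IH(1)[OF z, of A' B' g Z'] len by simp
    qed
  }
qed

end

theorem theorem1p3:
  fixes F :: "('a, 'b) pre_digraph" and n :: nat
  assumes "weakly_S_K13_free_forest F"
    and "n = card (verts F)"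
  shows "real (\<gamma>\<^sub>g F) \<le> 3 * real n / 5 \<and> real (\<gamma>\<^sub>g' F) \<le> (3 * real n + 2) / 5"
proof -
  have "graph F"
    using assms(1) by (simp add: weakly_S_K13_free_forest_def undirected_forest_def)
  then interpret forest_game F
    using assms(1) by (simp add: forest_game_def forest_game_axioms_def)
  have "valid {} {} {} g {}" for g
    by (auto simp: valid_def)
  moreover have "potential {} {} = 3 * int n"
    using assms(2) by (simp add: potential_def weight_def)
  ultimately have "5 * int (\<gamma>\<^sub>g F) \<le> 3 * int n" "5 * int (\<gamma>\<^sub>g' F) \<le> 3 * int n + 2"
    using game_length_bound[of "{}" "{}" "{}" _ "{}"]
    by (simp_all add: game_domination_number_def staller_start_game_domination_number_def)
  then have "real_of_int (5 * int (\<gamma>\<^sub>g F)) \<le> real_of_int (3 * int n)"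
      "real_of_int (5 * int (\<gamma>\<^sub>g' F)) \<le> real_of_int (3 * int n + 2)"
    by (simp_all only: of_int_le_iff)
  then show ?thesis by simp
qed

end
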